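(* Let $(A_0,A_1)$ and $(B_0,B_1)$ be Banach couples with $A_0\subset A_1$. Let $T:A_1\to B_1$ be a (possibly nonlinear) map, and let $C_0,C_1>0$ be constants such that $$T(A_0)\subset B_0\quad\text{and}\quad \|T(a)\|_{B_0}\le C_0\|a\|_{A_0}\ \text{ for each } a\in A_0,$$ $$\|Ta-Ta'\|_{B_1}\le C_1\|a-a'\|_{A_1}\ \text{ for all } a,a'\in A_1.$$ Suppose, furthermore, that the couple $(B_0,B_1)$ has Arne Persson's property (H) (as defined in the context), and that there exists a compact subset $K$ of $B_0$ such that $$Ta\in \|a\|_{A_0}K\quad\text{for each } a\in A_0,$$ where $\lambda K=\{\lambda k: k\in K\}$. Then, for each $\theta\in(0,1)$ and each $p\in[1,\infty]$, $T$ maps every bounded subset of $(A_0,A_1)_{\theta,p}$ to a relatively compact subset of $(B_0,B_1)_{\theta,p}$.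
   Context: A Banach couple $(X_0,X_1)$ is a pair of Banach spaces continuously embedded in a common Hausdorff topological vector space. $X_0+X_1$ is normed by $\|x\|_{X_0+X_1}=\inf\{\|x_0\|_{X_0}+\|x_1\|_{X_1}: x=x_0+x_1,\ x_j\in X_j\}$ and $X_0\cap X_1$ by $\max\{\|x\|_{X_0},\|x\|_{X_1}\}$. For $t>0$ and $x\in X_0+X_1$, the Peetre $K$-functional is $$K(t,x;X_0,X_1)=\inf\{\|x_0\|_{X_0}+t\|x_1\|_{X_1}: x=x_0+x_1,\ x_0\in X_0,\ x_1\in X_1\}.$$ For $\theta\in(0,1)$ and $p\in[1,\infty]$, the real interpolation space $(X_0,X_1)_{\theta,p}$ consists of all $x\in X_0+X_1$ for which the norm $$\|x\|_{(X_0,X_1)_{\theta,p}}=\left(\int_0^\infty \left(t^{-\theta}K(t,x;X_0,X_1)\right)^p\frac{dt}{t}\right)^{1/p}$$ is finite, with $\|x\|_{(X_0,X_1)_{\theta,\infty}}=\sup_{t>0}t^{-\theta}K(t,x;X_0,X_1)$ when $p=\infty$. Since $A_0\subset A_1$, one has $A_0+A_1=A_1$, so $T$ is defined on $(A_0,A_1)_{\theta,p}\subset A_1$. Property (H) of a Banach couple $(B_0,B_1)$: for each compact subset $K$ of $B_0$ there exist a positive constant $c(K)$ and a set $\mathcal{D}(K)$ of linear operators $P:B_0+B_1\to B_0\cap B_1$ which satisfy $$\|Pb\|_{B_j}\le c(K)\|b\|_{B_j}\quad\text{for each } b\in B_j \text{ and } j=0,1,$$ and, furthermore, for each $\varepsilon>0$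 there exists $P_\varepsilon\in\mathcal{D}(K)$ such that $$\|P_\varepsilon b-b\|_{B_0}<\varepsilon\quad\text{for each } b\in K.$$ *)

theory Defs
  imports "HOL-Analysis.Analysis"
begin

class hausdorff_tvs = real_vector + topological_ab_group_add + t2_space +
  assumes tendsto_scaleR_Pair:
    "LIM p (nhds c \<times>\<^sub>F nhds x). fst p *\<^sub>R snd p :> nhds (c *\<^sub>R x)"

instance real_normed_vector \<subseteq> hausdorff_tvs
  by standard (rule tendsto_scaleR[OF filterlim_fst filterlim_snd])

text \<open>A linear subspace of the ambient space together with its own norm.  The values of
  \<open>nrm\<close> outside \<open>carr\<close> are irrelevant.\<close>

record 'v nspace =
  carr :: "'v set"
  nrm :: "'v \<Rightarrow> real"

text \<open>The guard is there because \<open>Metric_space\<close> demands a nonnegative symmetric function on the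
  whole type, not just on the carrier.\<close>

definition ndist :: "('v::real_vector) nspace \<Rightarrow> 'v \<Rightarrow> 'v \<Rightarrow> real" where
  "ndist X x y = (if x \<in> carr X \<and> y \<in> carr X then nrm X (x - y) else 0)"

abbreviation ntopology :: "('v::real_vector) nspace \<Rightarrow> 'v topology" where
  "ntopology X \<equiv> Metric_space.mtopology (carr X) (ndist X)"

definition normed_subspace :: "('v::real_vector) nspace \<Rightarrow> bool" where
  "normed_subspace X \<longleftrightarrow>
     subspace (carr X) \<and>
     (\<forall>x\<in>carr X. 0 \<le> nrm X x) \<and>
     (\<forall>x\<in>carr X. nrm X x = 0 \<longleftrightarrow> x = 0) \<and>
     (\<forall>c. \<forall>x\<in>carr X. nrm X (c *\<^sub>R x) = \<bar>c\<bar> * nrm X x) \<and>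
     (\<forall>x\<in>carr X. \<forall>y\<in>carr X. nrm X (x + y) \<le> nrm X x + nrm X y)"

lemma normed_subspace_Metric_space:
  assumes "normed_subspace X"
  shows "Metric_space (carr X) (ndist X)"
proof
  have sub: "subspace (carr X)"
    and nn: "\<And>x. x \<in> carr X \<Longrightarrow> 0 \<le> nrm X x"
    and z: "\<And>x. x \<in> carr X \<Longrightarrow> nrm X x = 0 \<longleftrightarrow> x = 0"
    and h: "\<And>c x. x \<in> carr X \<Longrightarrow> nrm X (c *\<^sub>R x) = \<bar>c\<bar> * nrm X x"
    and tri: "\<And>x y. x \<in> carr X \<Longrightarrow> y \<in> carr X \<Longrightarrow> nrm X (x + y) \<le> nrm X x + nrm X y"
    using assms by (simp_all add: normed_subspace_def)
  note d = subspace_diff[OF sub]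
  fix x y z'
  show "0 \<le> ndist X x y"
    by (simp add: ndist_def nn d)
  show "ndist X x y = ndist X y x"
  proof (cases "x \<in> carr X \<and> y \<in> carr X")
    case True
    then have "nrm X (x - y) = nrm X (y - x)"
      using h[of "y - x" "-1"] d[of y x] by simp
    with True show ?thesis by (simp add: ndist_def)
  qed (auto simp: ndist_def)
  show "ndist X x y = 0 \<longleftrightarrow> x = y" if "x \<in> carr X" "y \<in> carr X"
    using that by (simp add: ndist_def z d)
  show "ndist X x z' \<le> ndist X x y + ndist X y z'"
    if "x \<in> carr X" "y \<in> carr X" "z' \<in> carr X"
    using that tri[of "x - y" "y - z'"] by (simp add: ndist_def d)
qed

definition embedded_banach :: "('v::hausdorff_tvs) nspace \<Rightarrow> bool" where
  "embedded_banach X \<longleftrightarrow>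
     normed_subspace X \<and>
     Metric_space.mcomplete (carr X) (ndist X) \<and>
     continuous_map (ntopology X) euclidean id"

definition banach_couple :: "('v::hausdorff_tvs) nspace \<Rightarrow> 'v nspace \<Rightarrow> bool" where
  "banach_couple X0 X1 \<longleftrightarrow> embedded_banach X0 \<and> embedded_banach X1"

definition couple_sum :: "('v::real_vector) nspace \<Rightarrow> 'v nspace \<Rightarrow> 'v set" where
  "couple_sum X0 X1 = {x0 + x1 |x0 x1. x0 \<in> carr X0 \<and> x1 \<in> carr X1}"

definition K_functional ::
  "('v::real_vector) nspace \<Rightarrow> 'v nspace \<Rightarrow> real \<Rightarrow> 'v \<Rightarrow> real" where
  "K_functional X0 X1 t x =
     Inf {nrm X0 x0 + t * nrm X1 x1 |x0 x1. x0 \<in> carr X0 \<and> x1 \<in> carr X1 \<and> x = x0 + x1}"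

text \<open>The interpolation norm with values in \<open>[0, \<infinity>]\<close>; the exponent \<open>p\<close> ranges over \<open>[1, \<infinity>]\<close>.\<close>

definition interp_enorm ::
  "('v::real_vector) nspace \<Rightarrow> 'v nspace \<Rightarrow> real \<Rightarrow> ennreal \<Rightarrow> 'v \<Rightarrow> ennreal" where
  "interp_enorm X0 X1 \<theta> p x =
     (if p = \<infinity> then SUP t\<in>{0<..}. ennreal (t powr (- \<theta>) * K_functional X0 X1 t x)
      else let r = enn2real p;
               I = (\<integral>\<^sup>+t\<in>{0<..}. ennreal ((t powr (- \<theta>) * K_functional X0 X1 t x) powr r / t) \<partial>lborel)
           in if I = \<infinity> then \<infinity> else ennreal (enn2real I powr (1 / r)))"

definition real_interp ::
  "('v::real_vector) nspace \<Rightarrow> 'v nspace \<Rightarrow> real \<Rightarrow> ennreal \<Rightarrow> 'v nspace" where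
  "real_interp X0 X1 \<theta> p =
     \<lparr>carr = {x \<in> couple_sum X0 X1. interp_enorm X0 X1 \<theta> p x < \<infinity>},
      nrm = (\<lambda>x. enn2real (interp_enorm X0 X1 \<theta> p x))\<rparr>"

definition linear_between :: "('v::real_vector) set \<Rightarrow> ('w::real_vector) set \<Rightarrow> ('v \<Rightarrow> 'w) \<Rightarrow> bool" where
  "linear_between V W P \<longleftrightarrow>
     P \<in> V \<rightarrow> W \<and>
     (\<forall>x\<in>V. \<forall>y\<in>V. P (x + y) = P x + P y) \<and>
     (\<forall>c. \<forall>x\<in>V. P (c *\<^sub>R x) = c *\<^sub>R P x)"

definition property_H :: "('w::real_vector) nspace \<Rightarrow> 'w nspace \<Rightarrow> bool" where
  "property_H B0 B1 \<longleftrightarrow>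
     (\<forall>K. compactin (ntopology B0) K \<longrightarrow>
        (\<exists>c>0. \<exists>\<D> :: ('w \<Rightarrow> 'w) set.
           (\<forall>P\<in>\<D>. linear_between (couple_sum B0 B1) (carr B0 \<inter> carr B1) P \<and>
              (\<forall>b\<in>carr B0. nrm B0 (P b) \<le> c * nrm B0 b) \<and>
              (\<forall>b\<in>carr B1. nrm B1 (P b) \<le> c * nrm B1 b)) \<and>
           (\<forall>\<epsilon>>0. \<exists>P\<in>\<D>. \<forall>b\<in>K. nrm B0 (P b - b) < \<epsilon>)))"

definition bounded_in :: "'v nspace \<Rightarrow> 'v set \<Rightarrow> bool" where
  "bounded_in X S \<longleftrightarrow> S \<subseteq> carr X \<and> (\<exists>M. \<forall>x\<in>S. nrm X x \<le> M)"

text \<open>The inclusion is needed since \<open>closure_of\<close> ignores points outside the space.\<close>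

definition relatively_compact_in :: "('v::real_vector) nspace \<Rightarrow> 'v set \<Rightarrow> bool" where
  "relatively_compact_in X S \<longleftrightarrow>
     S \<subseteq> carr X \<and> compactin (ntopology X) (ntopology X closure_of S)"

end

theory Submission
  imports Defs
begin

text \<open>
  Total boundedness of \<open>T ` S\<close> suffices, since the target space is complete
  (\<open>mcomplete_real_interp\<close>).  It is obtained by approximating \<open>T\<close> by \<open>P \<circ> T\<close>, where \<open>P\<close> is one of
  the operators supplied by property (H) for the compact set \<open>K\<close>.

  The error \<open>T - P \<circ> T\<close> is small.  Split \<open>a = a0 + a1\<close>.  Then \<open>T a0 - P (T a0)\<close> has norm at most
  \<open>\<epsilon> * nrm A0 a0\<close> in \<open>B0\<close>, because \<open>T a0\<close> is \<open>nrm A0 a0\<close> times a point of \<open>K\<close>, and the error at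
  \<open>T a - T a0\<close> has norm at most \<open>(1 + c) * C1 * nrm A1 a1\<close> in \<open>B1\<close>, where \<open>c\<close> does not depend on
  \<open>P\<close>.  This bounds the \<open>K_functional\<close> of the error, and after the substitution \<open>t \<mapsto> \<beta> t\<close> in the
  interpolation norm the error is of order \<open>\<epsilon>\<close> to the power \<open>1 - \<theta>\<close>
  (\<open>smoothing_error\<close>).

  The map \<open>P \<circ> T\<close> sends bounded sets to totally bounded ones.  The values of \<open>P\<close> lie in
  \<open>B0 \<inter> B1\<close>, so by the closed graph theorem \<open>P\<close> is bounded from \<open>B1\<close> to \<open>B0\<close> and from \<open>B0\<close> to
  \<open>B1\<close>.  Hence \<open>P \<circ> T\<close> is Lipschitz from \<open>A1\<close> into \<open>B0 \<inter> B1\<close>, and it maps balls of \<open>A0\<close> to totally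
  bounded subsets of \<open>B0 \<inter> B1\<close>.  The bound \<open>K_functional A0 A1 t a \<le> 4 * t powr \<theta> * m\<close> on the ball
  of radius \<open>m\<close> gives splittings \<open>a = a0 + a1\<close> with \<open>a0\<close> bounded and \<open>nrm A1 a1\<close> of order
  \<open>t powr (\<theta> - 1)\<close>, which is as small as desired for large \<open>t\<close>.  So \<open>P (T a)\<close> is uniformly close
  to \<open>P (T a0)\<close> in \<open>B0 \<inter> B1\<close>, which embeds continuously into the interpolation space
  (\<open>smoothed_image_finite_net\<close>).

  The analytic facts about the interpolation norm (Minkowski's inequality, dilation, growth, lower
  semicontinuity) concern only the function \<open>t \<mapsto> K_functional X0 X1 t x\<close> and are proved for
  arbitrary nonnegative increasing functions.
\<close>

section \<open>Normed subspaces as metric spaces\<close>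

lemma LIMSEQ_squeeze_zero:
  fixes f g :: "nat \<Rightarrow> real"
  assumes "g \<longlonglongrightarrow> 0" "\<And>n. 0 \<le> f n" "\<And>n. f n \<le> g n"
  shows "f \<longlonglongrightarrow> 0"
  by (rule tendsto_sandwich[OF _ _ tendsto_const assms(1)]) (use assms in auto)

context
  fixes X :: "('v::real_vector) nspace"
  assumes X: "normed_subspace X"
begin

lemma subspace_carr: "subspace (carr X)"
  using X by (simp add: normed_subspace_def)

lemma nrm_nonneg: "x \<in> carr X \<Longrightarrow> 0 \<le> nrm X x"
  using X by (simp add: normed_subspace_def)

lemma nrm_eq_0_iff: "x \<in> carr X \<Longrightarrow> nrm X x = 0 \<longleftrightarrow> x = 0"
  using X by (simp add: normed_subspace_def)

lemma nrm_scaleR: "x \<in> carr X \<Longrightarrow> nrm X (c *\<^sub>R x) = \<bar>c\<bar> * nrm X x"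
  using X by (simp add: normed_subspace_def)

lemma nrm_add_le: "x \<in> carr X \<Longrightarrow> y \<in> carr X \<Longrightarrow> nrm X (x + y) \<le> nrm X x + nrm X y"
  using X by (simp add: normed_subspace_def)

lemma nrm_zero: "nrm X 0 = 0"
  using nrm_eq_0_iff subspace_0[OF subspace_carr] by blast

lemma nrm_minus_commute:
  assumes "x \<in> carr X" "y \<in> carr X"
  shows "nrm X (x - y) = nrm X (y - x)"
  using nrm_scaleR[of "y - x" "-1"] subspace_diff[OF subspace_carr] assms by simp

lemma nrm_diff_le:
  assumes "x \<in> carr X" "y \<in> carr X"
  shows "nrm X (x - y) \<le> nrm X x + nrm X y"
  using nrm_add_le[of x "-y"] nrm_scaleR[of y "-1"] subspace_neg[OF subspace_carr] assms by simp

lemma nrm_triangle: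
  assumes "x \<in> carr X" "y \<in> carr X" "z \<in> carr X"
  shows "nrm X (x - z) \<le> nrm X (x - y) + nrm X (y - z)"
  using nrm_add_le[of "x - y" "y - z"] subspace_diff[OF subspace_carr] assms by simp

lemma nrm_sum_le:
  assumes "\<And>i. i \<in> I \<Longrightarrow> u i \<in> carr X"
  shows "nrm X (\<Sum>i\<in>I. u i) \<le> (\<Sum>i\<in>I. nrm X (u i))"
  using assms
proof (induction I rule: infinite_finite_induct)
  case (insert i I)
  have "nrm X (u i + (\<Sum>i\<in>I. u i)) \<le> nrm X (u i) + nrm X (\<Sum>i\<in>I. u i)"
    using insert.prems by (intro nrm_add_le subspace_sum[OF subspace_carr]) auto
  with insert show ?case by force
qed (simp_all add: nrm_zero)

lemma limitin_ntopology_iff: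
  assumes "\<And>n. \<sigma> n \<in> carr X"
  shows "limitin (ntopology X) \<sigma> l sequentially \<longleftrightarrow>
    l \<in> carr X \<and> (\<lambda>n. nrm X (\<sigma> n - l)) \<longlonglongrightarrow> 0"
proof -
  interpret Metric_space "carr X" "ndist X"
    by (rule normed_subspace_Metric_space[OF X])
  show ?thesis
  proof (cases "l \<in> carr X")
    case True
    have "0 \<le> nrm X (\<sigma> n - l)" for n
      using assms True nrm_nonneg subspace_diff[OF subspace_carr] by blast
    with True show ?thesis
      using assms by (simp add: limit_metric_sequentially LIMSEQ_def dist_real_def ndist_def)
  qed (simp add: limit_metric_sequentially)
qed

lemma MCauchy_ntopology_iff:
  assumes "\<And>n. \<sigma> n \<in> carr X"
  shows "Metric_space.MCauchy (carr X) (ndist X) \<sigma> \<longleftrightarrow>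
    (\<forall>\<epsilon>>0. \<exists>N. \<forall>m\<ge>N. \<forall>n\<ge>N. nrm X (\<sigma> m - \<sigma> n) < \<epsilon>)"
proof -
  interpret Metric_space "carr X" "ndist X"
    by (rule normed_subspace_Metric_space[OF X])
  show ?thesis
    using assms by (auto simp: MCauchy_def ndist_def image_subset_iff)
qed

lemma geometric_partial_sums_diff_le:
  assumes u: "\<And>n. u n \<in> carr X" "\<And>n. nrm X (u n) \<le> c * (1/2)^n" and mn: "m \<le> n" and c: "0 \<le> c"
  shows "nrm X ((\<Sum>i<n. u i) - (\<Sum>i<m. u i)) \<le> 2 * c * (1/2)^m"
proof -
  have "(\<Sum>i<n. u i) - (\<Sum>i<m. u i) = (\<Sum>i=m..<n. u i)"
    using sum.atLeastLessThan_concat[of 0 m n u] mn by (simp add: lessThan_atLeast0 algebra_simps)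
  also have "nrm X (\<Sum>i=m..<n. u i) \<le> (\<Sum>i=m..<n. c * (1/2)^i)"
    by (rule order_trans[OF nrm_sum_le sum_mono]) (use u in auto)
  also have "\<dots> = c * (2 * (1/2)^m - 2 * (1/2)^n)"
    using mn
  proof (induction n rule: dec_induct)
    case (step n)
    then show ?case by (simp add: algebra_simps)
  qed simp
  also have "\<dots> \<le> 2 * c * (1/2)^m"
    using c by (simp add: algebra_simps)
  finally show ?thesis .
qed

lemma geometric_series_converges:
  assumes complete: "Metric_space.mcomplete (carr X) (ndist X)"
    and u: "\<And>n. u n \<in> carr X" "\<And>n. nrm X (u n) \<le> c * (1/2)^n"
  obtains l where "l \<in> carr X" "\<And>n. nrm X ((\<Sum>i<n. u i) - l) \<le> 2 * c * (1/2)^n"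
proof -
  interpret Metric_space "carr X" "ndist X"
    by (rule normed_subspace_Metric_space[OF X])
  define s where "s n = (\<Sum>i<n. u i)" for n
  have s: "s n \<in> carr X" for n
    unfolding s_def by (intro subspace_sum[OF subspace_carr] u)
  have c: "0 \<le> c"
    using nrm_nonneg[OF u(1)[of 0]] u(2)[of 0] by simp
  have diff: "nrm X (s n - s m) \<le> 2 * c * (1/2)^m" if "m \<le> n" for m n
    unfolding s_def by (rule geometric_partial_sums_diff_le) (use u that c in auto)
  have small: "(\<lambda>n. 2 * c * (1/2)^n) \<longlonglongrightarrow> 0"
    by (intro tendsto_mult_right_zero LIMSEQ_power_zero) simp
  have "MCauchy s"
    unfolding MCauchy_ntopology_iff[of s, OF s]
  proof (intro allI impI)
    fix \<epsilon> :: real assume "\<epsilon> > 0"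
    with small obtain N where N: "2 * c * (1/2)^n < \<epsilon>" if "n \<ge> N" for n
      using order_tendstoD(2)[OF small] unfolding eventually_sequentially by blast
    have "nrm X (s m - s n) < \<epsilon>" if "m \<ge> N" "n \<ge> N" for m n
    proof (cases "n \<le> m")
      case True
      then show ?thesis using diff[of n m] N that by force
    next
      case False
      then show ?thesis using diff[of m n] N that nrm_minus_commute[OF s s, of m n] by force
    qed
    then show "\<exists>N. \<forall>m\<ge>N. \<forall>n\<ge>N. nrm X (s m - s n) < \<epsilon>" by blast
  qed
  then obtain l where "limitin mtopology s l sequentially"
    using complete by (auto simp: mcomplete_def)
  then have l: "l \<in> carr X" and lim: "(\<lambda>n. nrm X (s n - l)) \<longlonglongrightarrow> 0"
    using limitin_ntopology_iff[of s, OF s] by auto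
  have "nrm X (s n - l) \<le> 2 * c * (1/2)^n" for n
  proof (rule LIMSEQ_le_const)
    show "(\<lambda>m. 2 * c * (1/2)^n + nrm X (s m - l)) \<longlonglongrightarrow> 2 * c * (1/2)^n"
      using tendsto_add[OF tendsto_const lim] by simp
    have "nrm X (s n - l) \<le> 2 * c * (1/2)^n + nrm X (s m - l)" if "n \<le> m" for m
      using nrm_triangle[OF s s l, of n m] diff[OF that] nrm_minus_commute[OF s s, of n m] by simp
    then show "\<exists>N. \<forall>m\<ge>N. nrm X (s n - l) \<le> 2 * c * (1/2)^n + nrm X (s m - l)"
      by blast
  qed
  with l that show thesis by (simp add: s_def)
qed

text \<open>A Cauchy sequence has a subsequence whose consecutive differences decay geometrically, and
  it converges as soon as that subsequence does.  So completeness need only be tested on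
  geometrically dominated series.\<close>

lemma mcomplete_if_geometric_series_converge:
  assumes series: "\<And>u. (\<And>n. u n \<in> carr X) \<Longrightarrow> (\<And>n. nrm X (u n) \<le> (1/2)^n) \<Longrightarrow>
    \<exists>l\<in>carr X. (\<lambda>n. nrm X ((\<Sum>i<n. u i) - l)) \<longlonglongrightarrow> 0"
  shows "Metric_space.mcomplete (carr X) (ndist X)"
proof -
  interpret Metric_space "carr X" "ndist X"
    by (rule normed_subspace_Metric_space[OF X])
  have "\<exists>l. limitin mtopology \<sigma> l sequentially" if cau: "MCauchy \<sigma>" for \<sigma>
  proof -
    have \<sigma>: "\<sigma> n \<in> carr X" for n
      using cau by (auto simp: MCauchy_def)
    have "\<forall>k. \<exists>N. \<forall>m\<ge>N. \<forall>n\<ge>N. nrm X (\<sigma> m - \<sigma> n) < (1/2)^k"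
      using cau unfolding MCauchy_ntopology_iff[of \<sigma>, OF \<sigma>] by simp
    then obtain N where N: "\<And>k m n. m \<ge> N k \<Longrightarrow> n \<ge> N k \<Longrightarrow> nrm X (\<sigma> m - \<sigma> n) < (1/2)^k"
      by metis
    \<comment> \<open>The sum dominates \<open>N k\<close>, and the summand \<open>k\<close> makes \<open>r\<close> strictly increasing.\<close>
    define r where "r k = k + (\<Sum>j\<le>k. N j)" for k
    have "strict_mono r"
      by (rule strict_monoI_Suc) (simp add: r_def)
    have "N k \<le> (\<Sum>j\<le>k. N j)" for k
      by (rule member_le_sum) auto
    then have r_ge: "r k \<ge> N k" for k
      unfolding r_def using trans_le_add2 by blast
    have "r k \<le> r (Suc k)" for k
      by (simp add: r_def)
    then have r_ge': "r (Suc k) \<ge> N k" for k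
      using r_ge order_trans by blast
    define u where "u k = \<sigma> (r (Suc k)) - \<sigma> (r k)" for k
    have u: "u k \<in> carr X" "nrm X (u k) \<le> (1/2)^k" for k
      using N[OF r_ge' r_ge, of k] subspace_diff[OF subspace_carr \<sigma> \<sigma>]
      by (simp_all add: u_def less_imp_le)
    obtain l where l: "l \<in> carr X" "(\<lambda>n. nrm X ((\<Sum>i<n. u i) - l)) \<longlonglongrightarrow> 0"
      using series[of u] u by blast
    have "(\<Sum>i<n. u i) - l = (\<sigma> \<circ> r) n - (l + \<sigma> (r 0))" for n
      unfolding u_def by (simp add: sum_lessThan_telescope[of "\<lambda>i. \<sigma> (r i)"])
    with l(2) have "(\<lambda>n. nrm X ((\<sigma> \<circ> r) n - (l + \<sigma> (r 0)))) \<longlonglongrightarrow> 0"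
      by (simp only:)
    then have "limitin mtopology (\<sigma> \<circ> r) (l + \<sigma> (r 0)) sequentially"
      using limitin_ntopology_iff[of "\<sigma> \<circ> r"] \<sigma> l(1) subspace_add[OF subspace_carr] by simp
    then show ?thesis
      using MCauchy_convergent_subsequence[OF cau \<open>strict_mono r\<close>] by blast
  qed
  then show ?thesis by (simp add: mcomplete_def)
qed

end

lemma embedded_banachD:
  assumes "embedded_banach X"
  shows "normed_subspace X" "Metric_space.mcomplete (carr X) (ndist X)"
    "continuous_map (ntopology X) euclidean id"
  using assms by (auto simp: embedded_banach_def)

lemma embedded_banach_tendsto:
  assumes X: "embedded_banach X" and "\<And>n. x n \<in> carr X" "l \<in> carr X"
    and "(\<lambda>n. nrm X (x n - l)) \<longlonglongrightarrow> 0"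
  shows "x \<longlonglongrightarrow> l"
proof -
  have "limitin (ntopology X) x l sequentially"
    using limitin_ntopology_iff[OF embedded_banachD(1)[OF X]] assms(2-4) by blast
  from continuous_map_limit[OF embedded_banachD(3)[OF X] this] show ?thesis
    by (simp add: o_def)
qed

section \<open>The closed graph theorem\<close>

context
  fixes V :: "'v::real_vector set" and W :: "'w::real_vector set" and P :: "'v \<Rightarrow> 'w"
  assumes P: "linear_between V W P"
begin

lemma linear_between_in: "x \<in> V \<Longrightarrow> P x \<in> W"
  using P by (auto simp: linear_between_def)

lemma linear_between_add: "x \<in> V \<Longrightarrow> y \<in> V \<Longrightarrow> P (x + y) = P x + P y"
  using P by (auto simp: linear_between_def)

lemma linear_between_scaleR: "x \<in> V \<Longrightarrow> P (c *\<^sub>R x) = c *\<^sub>R P x"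
  using P by (auto simp: linear_between_def)

lemma linear_between_diff:
  assumes "subspace V" "x \<in> V" "y \<in> V"
  shows "P (x - y) = P x - P y"
  using linear_between_add[of x "-y"] linear_between_scaleR[of y "-1"] subspace_neg[OF assms(1,3)] assms by simp

lemma linear_between_sum:
  assumes "subspace V" "\<And>i. i \<in> I \<Longrightarrow> u i \<in> V"
  shows "P (\<Sum>i\<in>I. u i) = (\<Sum>i\<in>I. P (u i))"
  using assms(2)
proof (induction I rule: infinite_finite_induct)
  case (insert i I)
  then show ?case
    by (simp add: linear_between_add subspace_sum[OF assms(1)])
qed (use linear_between_scaleR[of 0 0] subspace_0[OF assms(1)] in simp_all)

end

context
  fixes X :: "('v::real_vector) nspace" and Y :: "('w::real_vector) nspace" and P :: "'v \<Rightarrow> 'w"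
  assumes X: "normed_subspace X" and X_complete: "Metric_space.mcomplete (carr X) (ndist X)"
    and Y: "normed_subspace Y" and Y_complete: "Metric_space.mcomplete (carr Y) (ndist Y)"
    and P: "linear_between (carr X) (carr Y) P"
begin

lemmas P_in = linear_between_in[OF P] and P_scale = linear_between_scaleR[OF P]
  and P_diff = linear_between_diff[OF P subspace_carr[OF X]]
  and P_sum = linear_between_sum[OF P subspace_carr[OF X]]

text \<open>Baire's theorem makes the sublevel set of \<open>\<lambda>x. nrm Y (P x)\<close> at some level dense in a
  ball.  Differences of its points are dense near \<open>0\<close>, and homogeneity does the rest.\<close>

lemma almost_bounded:
  obtains c where "c > 0"
    "\<And>z \<delta>. z \<in> carr X \<Longrightarrow> \<delta> > 0 \<Longrightarrow> \<exists>w\<in>carr X. nrm X (z - w) < \<delta> \<and> nrm Y (P w) \<le> c * nrm X z"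
proof -
  interpret Metric_space "carr X" "ndist X"
    by (rule normed_subspace_Metric_space[OF X])
  note sub = subspace_carr[OF X]
  define D where "D n = {x \<in> carr X. nrm Y (P x) \<le> real n}" for n
  have DX: "D n \<subseteq> carr X" for n by (auto simp: D_def)
  have "\<exists>n. mtopology interior_of (mtopology closure_of D n) \<noteq> {}"
  proof (rule ccontr)
    assume "\<not> ?thesis"
    then have "mtopology interior_of (\<Union>n. mtopology closure_of D n) = {}"
      by (intro metric_Baire_category_alt[OF X_complete]) auto
    moreover have "(\<Union>n. mtopology closure_of D n) = carr X"
    proof
      show "(\<Union>n. mtopology closure_of D n) \<subseteq> carr X"
        using closure_of_subset_topspace[of mtopology] by auto
      have "\<exists>n. x \<in> D n" if "x \<in> carr X" for x
        using that real_arch_simple[of "nrm Y (P x)"] by (auto simp: D_def)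
      then show "carr X \<subseteq> (\<Union>n. mtopology closure_of D n)"
        using closure_of_subset[of "D n" mtopology for n] DX by fastforce
    qed
    ultimately have "carr X = {}"
      by (metis interior_of_topspace topspace_mtopology)
    then show False using subspace_0[OF sub] by auto
  qed
  then obtain n x0 where "x0 \<in> mtopology interior_of (mtopology closure_of D n)"
    by blast
  then obtain r where x0: "x0 \<in> carr X" and "r > 0" and ball: "mball x0 r \<subseteq> mtopology closure_of D n"
    unfolding metric_interior_of by blast
  have approx: "\<exists>w\<in>D n. nrm X (x - w) < \<delta>" if "x \<in> carr X" "nrm X (x - x0) < r" "\<delta> > 0" for x \<delta>
  proof -
    have "x \<in> mball x0 r"
      using that x0 nrm_minus_commute[OF X] by (simp add: ndist_def)
    with ball \<open>\<delta> > 0\<close> obtain w where "w \<in> D n" "w \<in> mball x \<delta>"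
      unfolding metric_closure_of by blast
    with DX that show ?thesis
      by (auto simp: ndist_def)
  qed
  have near0: "\<exists>w\<in>carr X. nrm X (z - w) < \<delta> \<and> nrm Y (P w) \<le> 2 * real n"
    if z: "z \<in> carr X" "nrm X z < r" and "\<delta> > 0" for z \<delta>
  proof -
    obtain w1 where w1: "w1 \<in> D n" "nrm X ((x0 + z) - w1) < \<delta>/2"
      using approx[of "x0 + z" "\<delta>/2"] z \<open>\<delta> > 0\<close> subspace_add[OF sub x0] by auto
    obtain w2 where w2: "w2 \<in> D n" "nrm X (x0 - w2) < \<delta>/2"
      using approx[of x0 "\<delta>/2"] x0 \<open>\<delta> > 0\<close> \<open>r > 0\<close> nrm_zero[OF X] by auto
    have in_X: "w1 \<in> carr X" "w2 \<in> carr X" "x0 + z - w1 \<in> carr X" "x0 - w2 \<in> carr X"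
      using w1 w2 DX x0 z by (auto intro!: subspace_add[OF sub] subspace_diff[OF sub])
    have "nrm X (z - (w1 - w2)) \<le> nrm X (x0 + z - w1) + nrm X (x0 - w2)"
      using nrm_diff_le[OF X in_X(3,4)] by (simp add: algebra_simps)
    then have "nrm X (z - (w1 - w2)) < \<delta>"
      using w1 w2 by simp
    moreover have "nrm Y (P (w1 - w2)) \<le> 2 * real n"
      using nrm_diff_le[OF Y P_in P_in, OF in_X(1,2)] w1 w2 by (simp add: P_diff[OF in_X(1,2)] D_def)
    ultimately show ?thesis
      using subspace_diff[OF sub in_X(1,2)] by blast
  qed
  \<comment> \<open>Rescaling \<open>z\<close> to norm \<open>r / 2\<close> costs the factor \<open>2 / r\<close>; adding \<open>1\<close> keeps \<open>c\<close> positive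
    when \<open>n = 0\<close>.\<close>
  define c where "c = 4 * real n / r + 1"
  have "\<exists>w\<in>carr X. nrm X (z - w) < \<delta> \<and> nrm Y (P w) \<le> c * nrm X z"
    if z: "z \<in> carr X" and "\<delta> > 0" for z \<delta>
  proof (cases "z = 0")
    case True
    have "P 0 = 0"
      using P_scale[of 0 0] subspace_0[OF sub] by simp
    then show ?thesis
      using True \<open>\<delta> > 0\<close> z nrm_zero[OF X] nrm_zero[OF Y] by (intro bexI[of _ 0]) auto
  next
    case False
    define s where "s = r / (2 * nrm X z)"
    have nz: "nrm X z > 0"
      using nrm_eq_0_iff[OF X z] nrm_nonneg[OF X z] False by simp
    then have s: "s > 0" using \<open>r > 0\<close> by (simp add: s_def)
    have "nrm X (s *\<^sub>R z) = r/2"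
      using nz s by (simp add: nrm_scaleR[OF X z]) (simp add: s_def)
    then obtain w where w: "w \<in> carr X" "nrm X (s *\<^sub>R z - w) < s * \<delta>" "nrm Y (P w) \<le> 2 * real n"
      using near0[of "s *\<^sub>R z" "s * \<delta>"] z s \<open>\<delta> > 0\<close> \<open>r > 0\<close> subspace_scale[OF sub z] by auto
    define w' where "w' = (1/s) *\<^sub>R w"
    have w': "w' \<in> carr X" "w = s *\<^sub>R w'"
      using subspace_scale[OF sub w(1)] s by (auto simp: w'_def)
    have "s * nrm X (z - w') < s * \<delta>"
      using w(2) nrm_scaleR[OF X subspace_diff[OF sub z w'(1)], of s] s
      by (simp add: w'(2) scaleR_right_diff_distrib)
    then have "nrm X (z - w') < \<delta>" using s by simp
    moreover have "s * nrm Y (P w') \<le> 2 * real n"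
      using w(3) s by (simp add: w'(2) P_scale[OF w'(1)] nrm_scaleR[OF Y P_in[OF w'(1)]])
    then have "nrm Y (P w') \<le> 2 * real n / s"
      using s by (simp add: field_simps)
    moreover have "2 * real n / s \<le> c * nrm X z"
      using nz \<open>r > 0\<close> by (simp add: s_def c_def field_simps)
    ultimately show ?thesis using w'(1) by force
  qed
  moreover have "c > 0" using \<open>r > 0\<close> by (simp add: c_def add_nonneg_pos)
  ultimately show thesis using that by blast
qed

text \<open>Successive approximation: \<open>z\<close> is a sum of pieces whose images form a geometrically dominated
  series, and closedness identifies the sum of the images with \<open>P z\<close>.\<close>

theorem closed_graph_bounded:
  assumes closed: "\<And>x l y. (\<And>n. x n \<in> carr X) \<Longrightarrow> l \<in> carr X \<Longrightarrow> y \<in> carr Y \<Longrightarrow>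
    (\<lambda>n. nrm X (x n - l)) \<longlonglongrightarrow> 0 \<Longrightarrow> (\<lambda>n. nrm Y (P (x n) - y)) \<longlonglongrightarrow> 0 \<Longrightarrow> P l = y"
  obtains M where "M > 0" "\<And>x. x \<in> carr X \<Longrightarrow> nrm Y (P x) \<le> M * nrm X x"
proof -
  note sub = subspace_carr[OF X]
  obtain c where "c > 0" and
    c: "\<And>z \<delta>. z \<in> carr X \<Longrightarrow> \<delta> > 0 \<Longrightarrow> \<exists>w\<in>carr X. nrm X (z - w) < \<delta> \<and> nrm Y (P w) \<le> c * nrm X z"
    using almost_bounded by blast
  have "nrm Y (P z) \<le> 2 * c * nrm X z" if z: "z \<in> carr X" for z
  proof (cases "z = 0")
    case True
    then show ?thesis
      using P_scale[of 0 0] subspace_0[OF sub] nrm_zero[OF X] nrm_zero[OF Y] by simp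
  next
    case False
    define a where "a = nrm X z"
    have "a > 0"
      using nrm_eq_0_iff[OF X z] nrm_nonneg[OF X z] False by (simp add: a_def)
    define W where "W n y = (SOME w. w \<in> carr X \<and> nrm X (y - w) < a * (1/2)^Suc n \<and>
        nrm Y (P w) \<le> c * nrm X y)" for n y
    have W: "W n y \<in> carr X" "nrm X (y - W n y) < a * (1/2)^Suc n"
      "nrm Y (P (W n y)) \<le> c * nrm X y" if y: "y \<in> carr X" for n y
    proof -
      have "0 < a * (1/2)^Suc n" using \<open>a > 0\<close> by simp
      from c[OF y this]
      have "\<exists>w. w \<in> carr X \<and> nrm X (y - w) < a * (1/2)^Suc n \<and> nrm Y (P w) \<le> c * nrm X y"
        by blast
      from someI_ex[OF this] show "W n y \<in> carr X" "nrm X (y - W n y) < a * (1/2)^Suc n"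
        "nrm Y (P (W n y)) \<le> c * nrm X y"
        by (simp_all add: W_def)
    qed
    define R where "R = rec_nat z (\<lambda>n y. y - W n y)"
    have R_Suc: "R (Suc n) = R n - W n (R n)" and R0: "R 0 = z" for n
      by (simp_all add: R_def)
    have R: "R n \<in> carr X" for n
      by (induction n) (auto simp: R_Suc R0 z intro!: subspace_diff[OF sub] W)
    have R_le: "nrm X (R n) \<le> a * (1/2)^n" for n
      using W(2)[OF R] by (cases n) (auto simp: R_Suc R0 a_def less_imp_le)
    define w where "w n = W n (R n)" for n
    have w: "w n \<in> carr X" for n
      by (simp add: w_def W R)
    have Pw: "nrm Y (P (w n)) \<le> (c * a) * (1/2)^n" for n
      using order_trans[OF W(3)[OF R] mult_left_mono[OF R_le, of c]] \<open>c > 0\<close>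
      by (simp add: w_def mult.assoc)
    have R_eq: "R n = z - (\<Sum>i<n. w i)" for n
      by (induction n) (simp_all add: R0 R_Suc w_def)
    obtain y where y: "y \<in> carr Y" "\<And>n. nrm Y ((\<Sum>i<n. P (w i)) - y) \<le> 2 * (c * a) * (1/2)^n"
      using geometric_series_converges[OF Y Y_complete, of "\<lambda>i. P (w i)"] P_in[OF w] Pw by blast
    have s: "(\<Sum>i<n. w i) \<in> carr X" for n
      by (intro subspace_sum[OF sub] w)
    have "P z = y"
    proof (rule closed[of "\<lambda>n. \<Sum>i<n. w i"])
      have "(\<lambda>n. a * (1/2)^n) \<longlonglongrightarrow> 0"
        by (intro tendsto_mult_right_zero LIMSEQ_power_zero) simp
      moreover have "0 \<le> nrm X ((\<Sum>i<n. w i) - z)" "nrm X ((\<Sum>i<n. w i) - z) \<le> a * (1/2)^n" for n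
        using R_le[of n] nrm_nonneg[OF X R, of n] nrm_minus_commute[OF X s z]
        by (simp_all add: R_eq)
      ultimately show "(\<lambda>n. nrm X ((\<Sum>i<n. w i) - z)) \<longlonglongrightarrow> 0"
        by (rule LIMSEQ_squeeze_zero)
      have "(\<lambda>n. 2 * (c * a) * (1/2)^n) \<longlonglongrightarrow> 0"
        by (intro tendsto_mult_right_zero LIMSEQ_power_zero) simp
      moreover have "0 \<le> nrm Y ((\<Sum>i<n. P (w i)) - y)" for n
        by (intro nrm_nonneg[OF Y] subspace_diff[OF subspace_carr[OF Y]]
            subspace_sum[OF subspace_carr[OF Y]] P_in w y)
      ultimately show "(\<lambda>n. nrm Y (P (\<Sum>i<n. w i) - y)) \<longlonglongrightarrow> 0"
        unfolding P_sum[OF w] using y(2) by (rule LIMSEQ_squeeze_zero)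
    qed (use s z y in auto)
    moreover have "nrm Y (0 - y) \<le> 2 * (c * a)"
      using y(2)[of 0] by simp
    moreover have "nrm Y (0 - y) = nrm Y y"
      using nrm_minus_commute[OF Y subspace_0[OF subspace_carr[OF Y]] y(1)] by simp
    ultimately show ?thesis by (simp add: a_def)
  qed
  then show thesis using that[of "2 * c"] \<open>c > 0\<close> by simp
qed

end

section \<open>The weighted Lebesgue norm of a K-functional\<close>

text \<open>\<open>interp_enorm\<close> depends on the couple and on the vector only through the function
  \<open>t \<mapsto> K_functional X0 X1 t x\<close>, the argument \<open>k\<close> here.\<close>

definition weighted_enorm :: "real \<Rightarrow> ennreal \<Rightarrow> (real \<Rightarrow> real) \<Rightarrow> ennreal" where
  "weighted_enorm \<theta> p k =
     (if p = \<infinity> then SUP t\<in>{0<..}. ennreal (t powr (- \<theta>) * k t)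
      else let r = enn2real p;
               I = (\<integral>\<^sup>+t\<in>{0<..}. ennreal ((t powr (- \<theta>) * k t) powr r / t) \<partial>lborel)
           in if I = \<infinity> then \<infinity> else ennreal (enn2real I powr (1 / r)))"

lemma interp_enorm_eq: "interp_enorm X0 X1 \<theta> p x = weighted_enorm \<theta> p (\<lambda>t. K_functional X0 X1 t x)"
  by (simp add: interp_enorm_def weighted_enorm_def)

text \<open>Monotonicity is what makes the integrands measurable; the values at arguments \<open>t \<le> 0\<close>
  stay arbitrary because the infimum in \<open>K_functional\<close> may range over a set unbounded below when
  \<open>t\<close> is negative.\<close>

definition increasing_profile :: "(real \<Rightarrow> real) \<Rightarrow> bool" where
  "increasing_profile k \<longleftrightarrow> (\<forall>t>0. 0 \<le> k t) \<and> (\<forall>s t. 0 < s \<longrightarrow> s \<le> t \<longrightarrow> k s \<le> k t)"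

lemma increasing_profile_nonneg: "increasing_profile k \<Longrightarrow> 0 < t \<Longrightarrow> 0 \<le> k t"
  by (simp add: increasing_profile_def)

lemma increasing_profile_mono: "increasing_profile k \<Longrightarrow> 0 < s \<Longrightarrow> s \<le> t \<Longrightarrow> k s \<le> k t"
  by (simp add: increasing_profile_def)

definition weighted_integrand :: "real \<Rightarrow> real \<Rightarrow> (real \<Rightarrow> real) \<Rightarrow> real \<Rightarrow> ennreal" where
  "weighted_integrand \<theta> r k t = ennreal ((t powr (- \<theta>) * k t) powr r / t) * indicator {0<..} t"

lemma weighted_integrand_measurable:
  assumes k: "increasing_profile k"
  shows "weighted_integrand \<theta> r k \<in> borel_measurable borel"
proof -
  define g where "g t = (if 0 < t then k t else 0)" for t
  have "mono g"
    using k by (auto simp: mono_def g_def increasing_profile_def)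
  then have [measurable]: "g \<in> borel_measurable borel"
    by (rule borel_measurable_mono)
  have "weighted_integrand \<theta> r k = (\<lambda>t. ennreal ((t powr (- \<theta>) * g t) powr r / t) * indicator {0<..} t)"
    by (auto simp: weighted_integrand_def g_def indicator_def)
  also have "\<dots> \<in> borel_measurable borel"
    by measurable
  finally show ?thesis .
qed

lemma exponent_ge_1:
  assumes "1 \<le> p" "p \<noteq> (\<infinity>::ennreal)"
  shows "1 \<le> enn2real p"
  using assms by (cases p) auto

lemma weighted_enorm_top_le_iff:
  assumes "0 \<le> a"
  shows "weighted_enorm \<theta> \<infinity> k \<le> ennreal a \<longleftrightarrow> (\<forall>t>0. t powr (- \<theta>) * k t \<le> a)"
  using assms by (auto simp: weighted_enorm_def SUP_le_iff ennreal_le_iff)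

text \<open>The norm is handled through its upper bounds \<open>ennreal a\<close>, for which the root and the
  convention for infinite integrals disappear.\<close>

lemma weighted_enorm_le_iff:
  assumes p: "1 \<le> p" "p \<noteq> \<infinity>" and a: "0 \<le> a"
  shows "weighted_enorm \<theta> p k \<le> ennreal a \<longleftrightarrow>
    (\<integral>\<^sup>+t. weighted_integrand \<theta> (enn2real p) k t \<partial>lborel) \<le> ennreal (a powr enn2real p)"
proof -
  define r where "r = enn2real p"
  define I where "I = (\<integral>\<^sup>+t. weighted_integrand \<theta> r k t \<partial>lborel)"
  have r: "1 \<le> r" using exponent_ge_1[OF p] by (simp add: r_def)
  have eq: "weighted_enorm \<theta> p k = (if I = \<infinity> then \<infinity> else ennreal (enn2real I powr (1 / r)))"
    using p by (simp add: weighted_enorm_def I_def r_def weighted_integrand_def Let_def)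
  have "weighted_enorm \<theta> p k \<le> ennreal a \<longleftrightarrow> I \<le> ennreal (a powr r)"
  proof (cases I)
    case (real i)
    have "i powr (1/r) \<le> a \<longleftrightarrow> i \<le> a powr r"
    proof
      assume "i powr (1/r) \<le> a"
      then have "(i powr (1/r)) powr r \<le> a powr r"
        using r by (intro powr_mono2) auto
      then show "i \<le> a powr r"
        using r real by (simp add: powr_powr)
    next
      assume "i \<le> a powr r"
      then have "i powr (1/r) \<le> (a powr r) powr (1/r)"
        using r real by (intro powr_mono2) auto
      then show "i powr (1/r) \<le> a"
        using r a by (simp add: powr_powr)
    qed
    then show ?thesis
      using a real by (simp add: eq ennreal_le_iff)
  next
    case top
    then show ?thesis by (simp add: eq top_unique)
  qed
  then show ?thesis by (simp add: I_def r_def)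
qed

lemma weighted_enorm_mono:
  assumes p: "1 \<le> p" and kl: "\<And>t. 0 < t \<Longrightarrow> 0 \<le> k t" "\<And>t. 0 < t \<Longrightarrow> k t \<le> l t"
    and a: "0 \<le> a" "weighted_enorm \<theta> p l \<le> ennreal a"
  shows "weighted_enorm \<theta> p k \<le> ennreal a"
proof (cases "p = \<infinity>")
  case True
  then show ?thesis
    using a(2) kl unfolding True weighted_enorm_top_le_iff[OF a(1)]
    by (meson mult_left_mono order_trans powr_ge_zero)
next
  case False
  have "weighted_integrand \<theta> (enn2real p) k t \<le> weighted_integrand \<theta> (enn2real p) l t" for t
    using kl exponent_ge_1[OF p False]
    by (auto simp: weighted_integrand_def indicator_def
        intro!: ennreal_leI divide_right_mono powr_mono2 mult_left_mono)
  then show ?thesis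
    using a(2) unfolding weighted_enorm_le_iff[OF p False a(1)]
    by (meson nn_integral_mono order_trans)
qed

text \<open>The measure \<open>dt/t\<close> is invariant under the substitution \<open>t \<mapsto> \<beta> t\<close>, and the weight contributes
  the factor \<open>\<beta> powr \<theta>\<close>.\<close>

lemma weighted_enorm_dilate:
  assumes p: "1 \<le> p" and k: "increasing_profile k" and \<alpha>: "0 \<le> \<alpha>" and \<beta>: "0 < \<beta>"
    and a: "0 \<le> a" "weighted_enorm \<theta> p k \<le> ennreal a"
  shows "weighted_enorm \<theta> p (\<lambda>t. \<alpha> * k (\<beta> * t)) \<le> ennreal (\<alpha> * \<beta> powr \<theta> * a)"
proof -
  have nn: "0 \<le> \<alpha> * \<beta> powr \<theta> * a"
    using \<alpha> a by simp
  have weight: "t powr (- \<theta>) * (\<alpha> * k (\<beta> * t)) =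
      (\<alpha> * \<beta> powr \<theta>) * ((\<beta> * t) powr (- \<theta>) * k (\<beta> * t))" if "t > 0" for t
    using that \<beta> by (simp add: powr_mult powr_minus field_simps)
  show ?thesis
  proof (cases "p = \<infinity>")
    case True
    have "(\<beta> * t) powr (- \<theta>) * k (\<beta> * t) \<le> a" if "t > 0" for t
      using a(2) that \<beta> unfolding True weighted_enorm_top_le_iff[OF a(1)] by simp
    then have "t powr (- \<theta>) * (\<alpha> * k (\<beta> * t)) \<le> \<alpha> * \<beta> powr \<theta> * a" if "t > 0" for t
      unfolding weight[OF that] using \<alpha> that by (intro mult_left_mono) auto
    then show ?thesis
      unfolding True weighted_enorm_top_le_iff[OF nn] by blast
  next
    case False
    define r where "r = enn2real p"
    have r: "1 \<le> r" using exponent_ge_1[OF p False] by (simp add: r_def)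
    have eq: "weighted_integrand \<theta> r (\<lambda>t. \<alpha> * k (\<beta> * t)) t =
        ennreal ((\<alpha> * \<beta> powr \<theta>) powr r * \<beta>) * weighted_integrand \<theta> r k (\<beta> * t)" for t
    proof (cases "t > 0")
      case True
      define w where "w = (\<beta> * t) powr (- \<theta>) * k (\<beta> * t)"
      have w: "0 \<le> w"
        using increasing_profile_nonneg[OF k] True \<beta> by (simp add: w_def)
      have "((\<alpha> * \<beta> powr \<theta>) * w) powr r / t = ((\<alpha> * \<beta> powr \<theta>) powr r * \<beta>) * (w powr r / (\<beta> * t))"
        using True \<beta> \<alpha> w by (subst powr_mult) auto
      then show ?thesis
        using True \<beta> \<alpha> by (simp add: weighted_integrand_def weight w_def ennreal_mult[symmetric])
    next
      case False
      then show ?thesis using \<beta> by (simp add: weighted_integrand_def zero_less_mult_iff)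
    qed
    have meas: "weighted_integrand \<theta> r k \<in> borel_measurable borel"
      by (rule weighted_integrand_measurable[OF k])
    have "(\<integral>\<^sup>+t. weighted_integrand \<theta> r (\<lambda>t. \<alpha> * k (\<beta> * t)) t \<partial>lborel) =
        ennreal ((\<alpha> * \<beta> powr \<theta>) powr r * \<beta>) * (\<integral>\<^sup>+t. weighted_integrand \<theta> r k (\<beta> * t) \<partial>lborel)"
      unfolding eq by (intro nn_integral_cmult) (use meas in measurable)
    also have "\<dots> = ennreal ((\<alpha> * \<beta> powr \<theta>) powr r) * (\<integral>\<^sup>+t. weighted_integrand \<theta> r k t \<partial>lborel)"
      using \<beta> nn_integral_real_affine[OF meas, of \<beta> 0]
      by (simp add: ennreal_mult mult.assoc)
    also have "\<dots> \<le> ennreal ((\<alpha> * \<beta> powr \<theta>) powr r) * ennreal (a powr r)"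
      using a(2) unfolding weighted_enorm_le_iff[OF p False a(1)] r_def[symmetric]
      by (rule mult_left_mono) simp
    also have "\<dots> = ennreal ((\<alpha> * \<beta> powr \<theta> * a) powr r)"
      using \<alpha> a(1) by (simp add: ennreal_mult[symmetric] powr_mult)
    finally show ?thesis
      unfolding weighted_enorm_le_iff[OF p False nn] r_def .
  qed
qed

lemma powr_convex_combination:
  fixes u v x y r :: real
  assumes r: "1 \<le> r" and "0 \<le> u" "0 \<le> v" "u + v = 1" "0 \<le> x" "0 \<le> y"
  shows "(u * x + v * y) powr r \<le> u * x powr r + v * y powr r"
proof -
  have shrink: "(s * z) powr r \<le> s * z powr r" if "0 \<le> s" "s \<le> 1" "0 \<le> z" for s z :: real
  proof -
    have "s powr r \<le> s powr 1"
      using that r by (intro powr_mono') auto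
    then have "s powr r \<le> s" using that by simp
    then show ?thesis using that by (simp add: powr_mult mult_right_mono)
  qed
  consider "x = 0" | "y = 0" | "x > 0" "y > 0" using assms by linarith
  then show ?thesis
  proof cases
    case 3
    then show ?thesis
      using convex_onD[OF powr_convex[OF r], of v x y] assms by (simp add: eq_diff_eq[symmetric])
  qed (use shrink[of v y] shrink[of u x] assms in auto)
qed

text \<open>Minkowski's inequality, from convexity of \<open>x \<mapsto> x\<^sup>r\<close> applied to the
  normalised profiles \<open>k / a\<close> and \<open>l / b\<close>.\<close>

lemma weighted_enorm_add_pos:
  assumes p: "1 \<le> p" and k: "increasing_profile k" and l: "increasing_profile l"
    and a: "0 < a" "weighted_enorm \<theta> p k \<le> ennreal a"
    and b: "0 < b" "weighted_enorm \<theta> p l \<le> ennreal b"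
  shows "weighted_enorm \<theta> p (\<lambda>t. k t + l t) \<le> ennreal (a + b)"
proof -
  have nn: "0 \<le> a" "0 \<le> b" "0 \<le> a + b" using a b by auto
  show ?thesis
  proof (cases "p = \<infinity>")
    case True
    then show ?thesis
      using a(2) b(2) unfolding True weighted_enorm_top_le_iff[OF nn(1)]
        weighted_enorm_top_le_iff[OF nn(2)] weighted_enorm_top_le_iff[OF nn(3)]
      by (force simp: distrib_left intro: add_mono)
  next
    case False
    define r where "r = enn2real p"
    have r: "1 \<le> r" using exponent_ge_1[OF p False] by (simp add: r_def)
    \<comment> \<open>\<open>x + y\<close> is \<open>a + b\<close> times the convex combination of \<open>x / a\<close> and \<open>y / b\<close> with weights
      \<open>a / (a + b)\<close> and \<open>b / (a + b)\<close>; \<open>c\<close> and \<open>d\<close> collect the resulting factors.\<close>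
    define c where "c = (a + b) powr r * (a / (a + b)) / a powr r"
    define d where "d = (a + b) powr r * (b / (a + b)) / b powr r"
    have cd: "0 \<le> c" "0 \<le> d"
      using a b by (auto simp: c_def d_def)
    have pointwise: "(x + y) powr r \<le> c * x powr r + d * y powr r" if "0 \<le> x" "0 \<le> y" for x y
    proof -
      have "a / (a + b) * (x / a) = x / (a + b)" "b / (a + b) * (y / b) = y / (a + b)"
        using a b by simp_all
      then have split: "x + y = (a + b) * (a / (a + b) * (x / a) + b / (a + b) * (y / b))"
        using a b by (simp add: distrib_left)
      have "(x + y) powr r = (a + b) powr r * (a / (a + b) * (x / a) + b / (a + b) * (y / b)) powr r"
        unfolding split using a b that by (subst powr_mult) auto
      also have "\<dots> \<le> (a + b) powr r * (a / (a + b) * (x / a) powr r + b / (a + b) * (y / b) powr r)"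
        using a b that
        by (intro mult_left_mono powr_convex_combination r) (auto simp: add_divide_distrib[symmetric])
      also have "\<dots> = c * x powr r + d * y powr r"
        using a b that by (simp add: c_def d_def powr_divide distrib_left)
      finally show ?thesis .
    qed
    have "weighted_integrand \<theta> r (\<lambda>t. k t + l t) t \<le>
        ennreal c * weighted_integrand \<theta> r k t + ennreal d * weighted_integrand \<theta> r l t" for t
    proof (cases "t > 0")
      case True
      have "(t powr (- \<theta>) * (k t + l t)) powr r / t \<le>
          c * ((t powr (- \<theta>) * k t) powr r / t) + d * ((t powr (- \<theta>) * l t) powr r / t)"
        using pointwise[of "t powr (- \<theta>) * k t" "t powr (- \<theta>) * l t"] True
          increasing_profile_nonneg[OF k True] increasing_profile_nonneg[OF l True]
        by (simp add: distrib_left add_divide_distrib[symmetric] divide_right_mono)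
      then show ?thesis
        using True cd
        by (simp add: weighted_integrand_def ennreal_mult[symmetric] ennreal_plus[symmetric] ennreal_leI
            del: ennreal_plus)
    qed (simp add: weighted_integrand_def)
    then have "(\<integral>\<^sup>+t. weighted_integrand \<theta> r (\<lambda>t. k t + l t) t \<partial>lborel) \<le>
        (\<integral>\<^sup>+t. ennreal c * weighted_integrand \<theta> r k t + ennreal d * weighted_integrand \<theta> r l t \<partial>lborel)"
      by (rule nn_integral_mono)
    also have "\<dots> = ennreal c * (\<integral>\<^sup>+t. weighted_integrand \<theta> r k t \<partial>lborel) +
        ennreal d * (\<integral>\<^sup>+t. weighted_integrand \<theta> r l t \<partial>lborel)"
      using weighted_integrand_measurable[OF k] weighted_integrand_measurable[OF l]
      by (simp add: nn_integral_add nn_integral_cmult)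
    also have "\<dots> \<le> ennreal c * ennreal (a powr r) + ennreal d * ennreal (b powr r)"
      using a(2) b(2)
      unfolding weighted_enorm_le_iff[OF p False nn(1)] weighted_enorm_le_iff[OF p False nn(2)]
        r_def[symmetric]
      by (intro add_mono mult_left_mono) auto
    also have "\<dots> = ennreal (c * a powr r + d * b powr r)"
      using cd by (simp add: ennreal_mult ennreal_plus)
    also have "c * a powr r + d * b powr r = (a + b) powr r"
      using a b by (simp add: c_def d_def distrib_left[symmetric] add_divide_distrib[symmetric])
    finally show ?thesis
      unfolding weighted_enorm_le_iff[OF p False nn(3)] r_def .
  qed
qed

lemma weighted_enorm_add:
  assumes p: "1 \<le> p" and k: "increasing_profile k" and l: "increasing_profile l"
    and a: "0 \<le> a" "weighted_enorm \<theta> p k \<le> ennreal a"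
    and b: "0 \<le> b" "weighted_enorm \<theta> p l \<le> ennreal b"
  shows "weighted_enorm \<theta> p (\<lambda>t. k t + l t) \<le> ennreal (a + b)"
proof (rule ennreal_le_epsilon)
  fix e :: real assume "0 < e"
  have "weighted_enorm \<theta> p k \<le> ennreal (a + e/2)" "weighted_enorm \<theta> p l \<le> ennreal (b + e/2)"
    using a b \<open>0 < e\<close> by (auto elim!: order_trans intro!: ennreal_leI)
  then have "weighted_enorm \<theta> p (\<lambda>t. k t + l t) \<le> ennreal ((a + e/2) + (b + e/2))"
    using a b \<open>0 < e\<close> by (intro weighted_enorm_add_pos[OF p k l]) auto
  also have "(a + e/2) + (b + e/2) = (a + b) + e"
    by simp
  finally show "weighted_enorm \<theta> p (\<lambda>t. k t + l t) \<le> ennreal (a + b) + ennreal e"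
    using a b \<open>0 < e\<close> by (simp add: ennreal_plus[symmetric] del: ennreal_plus)
qed

text \<open>An increasing profile is at least \<open>k t\<close> on \<open>[t, 2t]\<close>, and the part of the integral over this
  interval already controls \<open>k t\<close>.  The constant 4 serves all \<open>p\<close> and \<open>\<theta>\<close>.\<close>

lemma weighted_enorm_growth:
  assumes p: "1 \<le> p" and \<theta>: "0 < \<theta>" "\<theta> < 1" and k: "increasing_profile k" and t: "0 < t"
    and a: "0 \<le> a" "weighted_enorm \<theta> p k \<le> ennreal a"
  shows "k t \<le> 4 * t powr \<theta> * a"
proof (cases "p = \<infinity>")
  case True
  have "t powr (- \<theta>) * k t \<le> a"
    using a(2) t unfolding True weighted_enorm_top_le_iff[OF a(1)] by blast
  then have "k t \<le> t powr \<theta> * a"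
    using t by (simp add: powr_minus field_simps)
  also have "\<dots> \<le> 4 * t powr \<theta> * a"
    using a(1) by simp
  finally show ?thesis .
next
  case False
  define r where "r = enn2real p"
  have r: "1 \<le> r" using exponent_ge_1[OF p False] by (simp add: r_def)
  have kt: "0 \<le> k t" by (rule increasing_profile_nonneg[OF k t])
  define w where "w = (2 * t) powr (- \<theta>) * k t"
  have w: "0 \<le> w" using kt by (simp add: w_def)
  have "ennreal (w powr r / (2 * t)) * indicator {t..2*t} s \<le> weighted_integrand \<theta> r k s" for s
  proof (cases "s \<in> {t..2*t}")
    case True
    have "w \<le> s powr (- \<theta>) * k s"
      unfolding w_def using True t \<theta> increasing_profile_mono[OF k t, of s] kt
      by (intro mult_mono powr_mono2') auto
    then have "w powr r / (2 * t) \<le> (s powr (- \<theta>) * k s) powr r / s"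
      using True t r w by (intro frac_le powr_mono2) auto
    then show ?thesis
      using True t by (simp add: weighted_integrand_def ennreal_leI)
  qed simp
  then have "(\<integral>\<^sup>+s. ennreal (w powr r / (2 * t)) * indicator {t..2*t} s \<partial>lborel) \<le>
      (\<integral>\<^sup>+s. weighted_integrand \<theta> r k s \<partial>lborel)"
    by (rule nn_integral_mono)
  also have "\<dots> \<le> ennreal (a powr r)"
    using a(2) unfolding weighted_enorm_le_iff[OF p False a(1)] r_def .
  also have "(\<integral>\<^sup>+s. ennreal (w powr r / (2 * t)) * indicator {t..2*t} s \<partial>lborel) =
      ennreal (w powr r / 2)"
    using t by (simp add: nn_integral_cmult_indicator ennreal_mult[symmetric])
  finally have "w powr r \<le> 2 * a powr r"
    using a by (simp add: ennreal_le_iff)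
  also have "\<dots> \<le> 2 powr r * a powr r"
    using r powr_mono[of 1 r 2] by (intro mult_right_mono) auto
  also have "\<dots> = (2 * a) powr r"
    using a by (simp add: powr_mult)
  finally have "w \<le> 2 * a"
    using r w a powr_less_mono2[of r "2 * a" w] by (smt (verit))
  then have "k t \<le> (2 * t) powr \<theta> * (2 * a)"
    using t by (simp add: w_def powr_minus field_simps)
  also have "\<dots> = 2 powr \<theta> * t powr \<theta> * (2 * a)"
    using t by (simp add: powr_mult)
  also have "\<dots> \<le> 2 * t powr \<theta> * (2 * a)"
    using a \<theta> powr_mono[of \<theta> 1 2] by (intro mult_right_mono) auto
  finally show ?thesis by simp
qed

text \<open>For finite \<open>p\<close> with value \<open>r\<close>, both ends of the integral converge: near \<open>0\<close> the exponent is \<open>(1 - \<theta>) r - 1 > -1\<close> and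
  near \<open>\<infinity>\<close> it is \<open>- \<theta> r - 1 < -1\<close>.\<close>

lemma weighted_enorm_min_finite:
  assumes p: "1 \<le> p" and \<theta>: "0 < \<theta>" "\<theta> < 1"
  obtains C where "0 \<le> C" "weighted_enorm \<theta> p (\<lambda>t. min 1 t) \<le> ennreal C"
proof (cases "p = \<infinity>")
  case True
  have "t powr (- \<theta>) * min 1 t \<le> 1" if "t > 0" for t
  proof (cases "t \<le> 1")
    case True
    then have "t powr (- \<theta>) * min 1 t = t powr (1 - \<theta>)"
      using that by (simp add: powr_diff powr_minus field_simps)
    also have "\<dots> \<le> 1"
      using that True \<theta> powr_mono2[of "1 - \<theta>" t 1] by simp
    finally show ?thesis .
  next
    case False
    then show ?thesis
      using that \<theta> powr_mono2'[of "- \<theta>" 1 t] by simp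
  qed
  then have "weighted_enorm \<theta> p (\<lambda>t. min 1 t) \<le> ennreal 1"
    unfolding True by (subst weighted_enorm_top_le_iff) auto
  then show thesis using that[of 1] by simp
next
  case False
  define r where "r = enn2real p"
  have r: "1 \<le> r" using exponent_ge_1[OF p False] by (simp add: r_def)
  have e0: "(1 - \<theta>) * r - 1 > -1" and e1: "- \<theta> * r - 1 < -1"
    using r \<theta> by auto
  define J where "J = 1 powr ((1 - \<theta>) * r - 1 + 1) / ((1 - \<theta>) * r - 1 + 1)"
  define J' where "J' = - (1 powr (- \<theta> * r - 1 + 1)) / (- \<theta> * r - 1 + 1)"
  have J: "0 \<le> J" and J': "0 \<le> J'"
    using r \<theta> by (auto simp: J_def J'_def divide_nonpos_neg)
  have "weighted_integrand \<theta> r (\<lambda>t. min 1 t) t \<le>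
      ennreal (t powr ((1 - \<theta>) * r - 1)) * indicator {0..1} t +
      ennreal (t powr (- \<theta> * r - 1)) * indicator {1..} t" for t
  proof -
    consider "t \<le> 0" | "0 < t" "t \<le> 1" | "1 < t" by linarith
    then show ?thesis
    proof cases
      case 2
      have "t powr (- \<theta>) * min 1 t = t powr (1 - \<theta>)"
        using 2 by (simp add: powr_diff powr_minus field_simps)
      then have "(t powr (- \<theta>) * min 1 t) powr r / t = (t powr (1 - \<theta>)) powr r / t"
        by simp
      also have "\<dots> = t powr ((1 - \<theta>) * r - 1)"
        using 2 powr_diff[of t "(1 - \<theta>) * r" 1] by (simp add: powr_powr)
      finally show ?thesis using 2 by (simp add: weighted_integrand_def)
    next
      case 3
      then show ?thesis
        by (simp add: weighted_integrand_def powr_powr powr_diff)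
    qed (simp add: weighted_integrand_def)
  qed
  then have "(\<integral>\<^sup>+t. weighted_integrand \<theta> r (\<lambda>t. min 1 t) t \<partial>lborel) \<le>
      (\<integral>\<^sup>+t. (ennreal (t powr ((1 - \<theta>) * r - 1)) * indicator {0..1} t +
      ennreal (t powr (- \<theta> * r - 1)) * indicator {1..} t) \<partial>lborel)"
    by (rule nn_integral_mono)
  also have "\<dots> = (\<integral>\<^sup>+t. ennreal (t powr ((1 - \<theta>) * r - 1)) * indicator {0..1} t \<partial>lborel) +
      (\<integral>\<^sup>+t. ennreal (t powr (- \<theta> * r - 1)) * indicator {1..} t \<partial>lborel)"
    by (rule nn_integral_add) measurable
  also have "\<dots> = ennreal J + ennreal J'"
    unfolding J_def J'_def
    by (intro arg_cong2[of _ _ _ _ "(+)"] nn_integral_has_integral_lebesgue'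
        has_integral_powr_from_0[OF e0] has_integral_powr_to_inf[OF e1]) auto
  also have "\<dots> = ennreal (((J + J') powr (1/r)) powr r)"
    using J J' r by (simp add: powr_powr)
  finally have "weighted_enorm \<theta> p (\<lambda>t. min 1 t) \<le> ennreal ((J + J') powr (1/r))"
    using weighted_enorm_le_iff[OF p False] by (simp add: r_def)
  then show thesis using that[of "(J + J') powr (1/r)"] by simp
qed

text \<open>Lower semicontinuity: Fatou's lemma, and for \<open>p = \<infinity>\<close> the closedness of \<open>\<le>\<close>.\<close>

lemma weighted_enorm_limit:
  assumes p: "1 \<le> p" and k: "\<And>n. increasing_profile (k n)"
    and lim: "\<And>t. 0 < t \<Longrightarrow> (\<lambda>n. k n t) \<longlonglongrightarrow> l t"
    and a: "0 \<le> a" "\<And>n. weighted_enorm \<theta> p (k n) \<le> ennreal a"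
  shows "weighted_enorm \<theta> p l \<le> ennreal a"
proof (cases "p = \<infinity>")
  case True
  have "t powr (- \<theta>) * l t \<le> a" if "t > 0" for t
  proof (rule LIMSEQ_le_const2)
    show "(\<lambda>n. t powr (- \<theta>) * k n t) \<longlonglongrightarrow> t powr (- \<theta>) * l t"
      by (intro tendsto_intros lim that)
    show "\<exists>N. \<forall>n\<ge>N. t powr (- \<theta>) * k n t \<le> a"
      using a(2) that unfolding True weighted_enorm_top_le_iff[OF a(1)] by blast
  qed
  then show ?thesis
    unfolding True weighted_enorm_top_le_iff[OF a(1)] by blast
next
  case False
  define r where "r = enn2real p"
  have r: "1 \<le> r" using exponent_ge_1[OF p False] by (simp add: r_def)
  have "(\<lambda>n. weighted_integrand \<theta> r (k n) t) \<longlonglongrightarrow> weighted_integrand \<theta> r l t" for t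
  proof (cases "t > 0")
    case True
    have "(\<lambda>n. ennreal ((t powr (- \<theta>) * k n t) powr r / t)) \<longlonglongrightarrow>
        ennreal ((t powr (- \<theta>) * l t) powr r / t)"
      using True r increasing_profile_nonneg[OF k True]
      by (intro tendsto_ennrealI tendsto_divide tendsto_powr' tendsto_mult tendsto_const lim) auto
    with True show ?thesis by (simp add: weighted_integrand_def)
  qed (simp add: weighted_integrand_def)
  then have "weighted_integrand \<theta> r l t = liminf (\<lambda>n. weighted_integrand \<theta> r (k n) t)" for t
    by (metis lim_imp_Liminf trivial_limit_sequentially)
  then have "(\<integral>\<^sup>+t. weighted_integrand \<theta> r l t \<partial>lborel) =
      (\<integral>\<^sup>+t. liminf (\<lambda>n. weighted_integrand \<theta> r (k n) t) \<partial>lborel)"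
    by simp
  also have "\<dots> \<le> liminf (\<lambda>n. \<integral>\<^sup>+t. weighted_integrand \<theta> r (k n) t \<partial>lborel)"
    using weighted_integrand_measurable[OF k] by (intro nn_integral_liminf) simp
  also have "\<dots> \<le> ennreal (a powr r)"
    using a(2) unfolding weighted_enorm_le_iff[OF p False a(1)] r_def[symmetric]
    by (intro Liminf_le) auto
  finally show ?thesis
    unfolding weighted_enorm_le_iff[OF p False a(1)] r_def .
qed

section \<open>The K-functional\<close>

context
  fixes X0 X1 :: "('v::real_vector) nspace"
  assumes X0: "normed_subspace X0" and X1: "normed_subspace X1"
begin

lemma subspace_couple_sum: "subspace (couple_sum X0 X1)"
proof -
  have "couple_sum X0 X1 = {x + y |x y. x \<in> carr X0 \<and> y \<in> carr X1}"
    by (simp add: couple_sum_def)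
  then show ?thesis
    using subspace_sums[OF subspace_carr[OF X0] subspace_carr[OF X1]] by simp
qed

lemma couple_sumI: "x0 \<in> carr X0 \<Longrightarrow> x1 \<in> carr X1 \<Longrightarrow> x0 + x1 \<in> couple_sum X0 X1"
  by (auto simp: couple_sum_def)

lemma couple_sumI0: "x \<in> carr X0 \<Longrightarrow> x \<in> couple_sum X0 X1"
  using couple_sumI[of x 0] subspace_0[OF subspace_carr[OF X1]] by simp

lemma couple_sumI1: "x \<in> carr X1 \<Longrightarrow> x \<in> couple_sum X0 X1"
  using couple_sumI[of 0 x] subspace_0[OF subspace_carr[OF X0]] by simp

lemma splitting_cost_nonneg:
  "x0 \<in> carr X0 \<Longrightarrow> x1 \<in> carr X1 \<Longrightarrow> 0 \<le> t \<Longrightarrow> 0 \<le> nrm X0 x0 + t * nrm X1 x1"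
  using nrm_nonneg[OF X0] nrm_nonneg[OF X1] by simp

lemma K_functional_le:
  assumes "x0 \<in> carr X0" "x1 \<in> carr X1" "0 \<le> t"
  shows "K_functional X0 X1 t (x0 + x1) \<le> nrm X0 x0 + t * nrm X1 x1"
  unfolding K_functional_def
proof (rule cInf_lower)
  show "bdd_below {nrm X0 y0 + t * nrm X1 y1 |y0 y1. y0 \<in> carr X0 \<and> y1 \<in> carr X1 \<and> x0 + x1 = y0 + y1}"
    using assms(3) splitting_cost_nonneg by (intro bdd_belowI[of _ 0]) blast
qed (use assms in blast)

lemma K_functional_greatest:
  assumes x: "x \<in> couple_sum X0 X1" and \<alpha>: "0 < \<alpha>"
    and le: "\<And>x0 x1. x0 \<in> carr X0 \<Longrightarrow> x1 \<in> carr X1 \<Longrightarrow> x = x0 + x1 \<Longrightarrow>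
      c \<le> \<alpha> * (nrm X0 x0 + t * nrm X1 x1)"
  shows "c \<le> \<alpha> * K_functional X0 X1 t x"
proof -
  have "c / \<alpha> \<le> K_functional X0 X1 t x"
    unfolding K_functional_def
  proof (rule cInf_greatest)
    show "{nrm X0 x0 + t * nrm X1 x1 |x0 x1. x0 \<in> carr X0 \<and> x1 \<in> carr X1 \<and> x = x0 + x1} \<noteq> {}"
      using x by (auto simp: couple_sum_def)
    fix s
    assume "s \<in> {nrm X0 x0 + t * nrm X1 x1 |x0 x1. x0 \<in> carr X0 \<and> x1 \<in> carr X1 \<and> x = x0 + x1}"
    then show "c / \<alpha> \<le> s"
      using le \<alpha> by (auto simp: field_simps)
  qed
  then show ?thesis using \<alpha> by (simp add: field_simps)
qed

lemma K_functional_nonneg: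
  "x \<in> couple_sum X0 X1 \<Longrightarrow> 0 \<le> t \<Longrightarrow> 0 \<le> K_functional X0 X1 t x"
  using K_functional_greatest[of x 1 0 t] splitting_cost_nonneg by simp

lemma K_functional_splitting:
  assumes x: "x \<in> couple_sum X0 X1" and less: "K_functional X0 X1 t x < s"
  obtains x0 x1 where "x0 \<in> carr X0" "x1 \<in> carr X1" "x = x0 + x1" "nrm X0 x0 + t * nrm X1 x1 < s"
proof -
  have "{nrm X0 x0 + t * nrm X1 x1 |x0 x1. x0 \<in> carr X0 \<and> x1 \<in> carr X1 \<and> x = x0 + x1} \<noteq> {}"
    using x by (auto simp: couple_sum_def)
  from cInf_lessD[OF this less[unfolded K_functional_def]] show thesis
    using that by blast
qed

lemma K_functional_mono:
  assumes "x \<in> couple_sum X0 X1" "0 \<le> s" "s \<le> t"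
  shows "K_functional X0 X1 s x \<le> K_functional X0 X1 t x"
proof -
  have "K_functional X0 X1 s x \<le> nrm X0 x0 + t * nrm X1 x1"
    if "x0 \<in> carr X0" "x1 \<in> carr X1" "x = x0 + x1" for x0 x1
    using K_functional_le[of x0 x1 s] that assms nrm_nonneg[OF X1, of x1]
      mult_right_mono[OF assms(3), of "nrm X1 x1"] by auto
  then show ?thesis
    using K_functional_greatest[of x 1 _ t] assms by simp
qed

lemma increasing_profile_K_functional:
  "x \<in> couple_sum X0 X1 \<Longrightarrow> increasing_profile (\<lambda>t. K_functional X0 X1 t x)"
  by (simp add: increasing_profile_def K_functional_nonneg K_functional_mono)

lemma K_functional_add:
  assumes x: "x \<in> couple_sum X0 X1" and y: "y \<in> couple_sum X0 X1" and t: "0 \<le> t"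
  shows "K_functional X0 X1 t (x + y) \<le> K_functional X0 X1 t x + K_functional X0 X1 t y"
proof (rule field_le_epsilon)
  fix e :: real assume "0 < e"
  obtain x0 x1 where x': "x0 \<in> carr X0" "x1 \<in> carr X1" "x = x0 + x1"
    "nrm X0 x0 + t * nrm X1 x1 < K_functional X0 X1 t x + e/2"
    using K_functional_splitting[OF x, of t "K_functional X0 X1 t x + e/2"] \<open>0 < e\<close> by auto
  obtain y0 y1 where y': "y0 \<in> carr X0" "y1 \<in> carr X1" "y = y0 + y1"
    "nrm X0 y0 + t * nrm X1 y1 < K_functional X0 X1 t y + e/2"
    using K_functional_splitting[OF y, of t "K_functional X0 X1 t y + e/2"] \<open>0 < e\<close> by auto
  have "K_functional X0 X1 t ((x0 + y0) + (x1 + y1)) \<le> nrm X0 (x0 + y0) + t * nrm X1 (x1 + y1)"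
    using x' y' t
    by (intro K_functional_le subspace_add[OF subspace_carr[OF X0]] subspace_add[OF subspace_carr[OF X1]])
  also have "\<dots> \<le> (nrm X0 x0 + nrm X0 y0) + t * (nrm X1 x1 + nrm X1 y1)"
    using x' y' t by (intro add_mono mult_left_mono nrm_add_le[OF X0] nrm_add_le[OF X1])
  finally show "K_functional X0 X1 t (x + y) \<le> K_functional X0 X1 t x + K_functional X0 X1 t y + e"
    using x'(3,4) y'(3,4) by (simp add: algebra_simps)
qed

lemma K_functional_scaleR_le:
  assumes x: "x \<in> couple_sum X0 X1" and t: "0 \<le> t"
  shows "K_functional X0 X1 t (c *\<^sub>R x) \<le> \<bar>c\<bar> * K_functional X0 X1 t x"
proof (cases "c = 0")
  case True
  then show ?thesis
    using K_functional_le[of 0 0 t] subspace_0[OF subspace_carr[OF X0]]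
      subspace_0[OF subspace_carr[OF X1]] t
    by (simp add: nrm_zero[OF X0] nrm_zero[OF X1])
next
  case False
  have "K_functional X0 X1 t (c *\<^sub>R x) \<le> \<bar>c\<bar> * (nrm X0 x0 + t * nrm X1 x1)"
    if "x0 \<in> carr X0" "x1 \<in> carr X1" "x = x0 + x1" for x0 x1
    using K_functional_le[of "c *\<^sub>R x0" "c *\<^sub>R x1" t] that t
      subspace_scale[OF subspace_carr[OF X0], of x0 c] subspace_scale[OF subspace_carr[OF X1], of x1 c]
    by (simp add: nrm_scaleR[OF X0] nrm_scaleR[OF X1] scaleR_right_distrib algebra_simps)
  with False show ?thesis
    by (intro K_functional_greatest[OF x]) auto
qed

lemma K_functional_diff_le:
  assumes x: "x \<in> couple_sum X0 X1" and y: "y \<in> couple_sum X0 X1" and t: "0 \<le> t"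
  shows "\<bar>K_functional X0 X1 t x - K_functional X0 X1 t y\<bar> \<le> K_functional X0 X1 t (x - y)"
proof -
  have d: "x - y \<in> couple_sum X0 X1"
    by (rule subspace_diff[OF subspace_couple_sum x y])
  have "K_functional X0 X1 t (y - x) \<le> K_functional X0 X1 t (x - y)"
    using K_functional_scaleR_le[OF d t, of "-1"] by simp
  then show ?thesis
    using K_functional_add[OF d y t] K_functional_add[OF subspace_neg[OF subspace_couple_sum d] x t]
    by (simp add: abs_le_iff)
qed

end

text \<open>Splittings of a vector of vanishing \<open>K_functional\<close> tend to \<open>0\<close> in both spaces, hence in the
  ambient space, where limits are unique.\<close>

lemma K_functional_zero_imp_zero:
  assumes X0: "embedded_banach X0" and X1: "embedded_banach X1"
    and x: "x \<in> couple_sum X0 X1" and K: "K_functional X0 X1 1 x \<le> 0"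
  shows "x = 0"
proof -
  note n0 = embedded_banachD(1)[OF X0] and n1 = embedded_banachD(1)[OF X1]
  have "\<exists>x0 x1. x0 \<in> carr X0 \<and> x1 \<in> carr X1 \<and> x = x0 + x1 \<and> nrm X0 x0 + 1 * nrm X1 x1 < 1 / real (Suc n)"
    for n
  proof -
    have "K_functional X0 X1 1 x < 1 / real (Suc n)"
      by (rule le_less_trans[OF K]) simp
    from K_functional_splitting[OF n0 n1 x this] show ?thesis
      by blast
  qed
  then obtain u v where uv: "u n \<in> carr X0" "v n \<in> carr X1" "x = u n + v n"
    "nrm X0 (u n) + 1 * nrm X1 (v n) < 1 / real (Suc n)" for n
    by metis
  have lim0: "(\<lambda>n. 1 / real (Suc n)) \<longlonglongrightarrow> 0"
    using LIMSEQ_inverse_real_of_nat by (simp add: inverse_eq_divide)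
  have b: "0 \<le> nrm X0 (u n)" "0 \<le> nrm X1 (v n)" "nrm X0 (u n) \<le> 1 / real (Suc n)"
    "nrm X1 (v n) \<le> 1 / real (Suc n)" for n
    using nrm_nonneg[OF n0 uv(1)[of n]] nrm_nonneg[OF n1 uv(2)[of n]] uv(4)[of n] by auto
  have "(\<lambda>n. nrm X0 (u n - 0)) \<longlonglongrightarrow> 0" "(\<lambda>n. nrm X1 (v n - 0)) \<longlonglongrightarrow> 0"
    using b by (auto intro!: LIMSEQ_squeeze_zero[OF lim0])
  then have "u \<longlonglongrightarrow> 0" "v \<longlonglongrightarrow> 0"
    using embedded_banach_tendsto[OF X0 uv(1) subspace_0[OF subspace_carr[OF n0]]]
      embedded_banach_tendsto[OF X1 uv(2) subspace_0[OF subspace_carr[OF n1]]] by auto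
  then have "(\<lambda>n. u n + v n) \<longlonglongrightarrow> 0 + 0"
    by (rule tendsto_add)
  then have "(\<lambda>n. x) \<longlonglongrightarrow> 0"
    using uv(3) by simp
  then show ?thesis
    by (simp add: LIMSEQ_const_iff)
qed

section \<open>The real interpolation space is a Banach space\<close>

lemma carr_real_interp:
  "carr (real_interp X0 X1 \<theta> p) = {x \<in> couple_sum X0 X1. interp_enorm X0 X1 \<theta> p x < \<infinity>}"
  by (simp add: real_interp_def)

lemma interp_enorm_le_nrm:
  assumes "x \<in> carr (real_interp X0 X1 \<theta> p)"
  shows "interp_enorm X0 X1 \<theta> p x \<le> ennreal (nrm (real_interp X0 X1 \<theta> p) x)"
  using assms by (simp add: real_interp_def)

lemma nrm_real_interp_nonneg: "0 \<le> nrm (real_interp X0 X1 \<theta> p) x"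
  by (simp add: real_interp_def)

lemma real_interpI:
  assumes "x \<in> couple_sum X0 X1" "0 \<le> a" "interp_enorm X0 X1 \<theta> p x \<le> ennreal a"
  shows "x \<in> carr (real_interp X0 X1 \<theta> p)" "nrm (real_interp X0 X1 \<theta> p) x \<le> a"
proof -
  show "x \<in> carr (real_interp X0 X1 \<theta> p)"
    using assms le_less_trans by (fastforce simp: carr_real_interp)
  show "nrm (real_interp X0 X1 \<theta> p) x \<le> a"
    using enn2real_mono[OF assms(3)] assms(2) by (simp add: real_interp_def)
qed

text \<open>Estimates of the \<open>K_functional\<close> by a dilated one carry over to the norm.  Operator bounds enter
  in this form: \<open>\<alpha>\<close> and \<open>\<alpha> \<beta>\<close> are the constants on the first and on the second space.\<close>

lemma interp_enorm_dominated:
  assumes X: "normed_subspace X0" "normed_subspace X1" and Y: "normed_subspace Y0" "normed_subspace Y1"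
    and p: "1 \<le> p" and x: "x \<in> couple_sum X0 X1" and y: "y \<in> couple_sum Y0 Y1"
    and \<alpha>: "0 \<le> \<alpha>" and \<beta>: "0 < \<beta>"
    and le: "\<And>t. 0 < t \<Longrightarrow> K_functional Y0 Y1 t y \<le> \<alpha> * K_functional X0 X1 (\<beta> * t) x"
    and a: "0 \<le> a" "interp_enorm X0 X1 \<theta> p x \<le> ennreal a"
  shows "interp_enorm Y0 Y1 \<theta> p y \<le> ennreal (\<alpha> * \<beta> powr \<theta> * a)"
  unfolding interp_enorm_eq
proof (rule weighted_enorm_mono[OF p])
  show "weighted_enorm \<theta> p (\<lambda>t. \<alpha> * K_functional X0 X1 (\<beta> * t) x) \<le> ennreal (\<alpha> * \<beta> powr \<theta> * a)"
    by (rule weighted_enorm_dilate[OF p increasing_profile_K_functional[OF X x] \<alpha> \<beta> a[unfolded interp_enorm_eq]])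
qed (use le K_functional_nonneg[OF Y y] \<alpha> a in auto)

lemma interp_enorm_add:
  assumes X: "normed_subspace X0" "normed_subspace X1" and p: "1 \<le> p"
    and x: "x \<in> couple_sum X0 X1" "0 \<le> a" "interp_enorm X0 X1 \<theta> p x \<le> ennreal a"
    and y: "y \<in> couple_sum X0 X1" "0 \<le> b" "interp_enorm X0 X1 \<theta> p y \<le> ennreal b"
  shows "interp_enorm X0 X1 \<theta> p (x + y) \<le> ennreal (a + b)"
  unfolding interp_enorm_eq
proof (rule weighted_enorm_mono[OF p])
  show "weighted_enorm \<theta> p (\<lambda>t. K_functional X0 X1 t x + K_functional X0 X1 t y) \<le> ennreal (a + b)"
    using x y unfolding interp_enorm_eq
    by (intro weighted_enorm_add p increasing_profile_K_functional X) auto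
qed (use x y K_functional_add[OF X] K_functional_nonneg[OF X] subspace_add[OF subspace_couple_sum[OF X]] in auto)

lemma interp_enorm_scaleR_le:
  assumes X: "normed_subspace X0" "normed_subspace X1" and p: "1 \<le> p"
    and x: "x \<in> couple_sum X0 X1" "0 \<le> a" "interp_enorm X0 X1 \<theta> p x \<le> ennreal a"
  shows "interp_enorm X0 X1 \<theta> p (c *\<^sub>R x) \<le> ennreal (\<bar>c\<bar> * a)"
proof -
  have "interp_enorm X0 X1 \<theta> p (c *\<^sub>R x) \<le> ennreal (\<bar>c\<bar> * 1 powr \<theta> * a)"
    by (rule interp_enorm_dominated[OF X X p x(1) _ _ _ _ x(2,3)])
      (use x(1) K_functional_scaleR_le[OF X x(1)] subspace_scale[OF subspace_couple_sum[OF X]] in auto)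
  then show ?thesis by simp
qed

lemma K_functional_growth:
  assumes X: "normed_subspace X0" "normed_subspace X1" and p: "1 \<le> p" and \<theta>: "0 < \<theta>" "\<theta> < 1"
    and x: "x \<in> couple_sum X0 X1" "0 \<le> a" "interp_enorm X0 X1 \<theta> p x \<le> ennreal a" and t: "0 < t"
  shows "K_functional X0 X1 t x \<le> 4 * t powr \<theta> * a"
  using weighted_enorm_growth[OF p \<theta> increasing_profile_K_functional[OF X x(1)] t x(2)] x(3)
  by (simp add: interp_enorm_eq)

text \<open>For \<open>x\<close> in the intersection the two trivial splittings bound the \<open>K_functional\<close> by
  \<open>m * min 1 t\<close>.\<close>

lemma intersection_subset_real_interp:
  assumes X: "normed_subspace X0" "normed_subspace X1" and p: "1 \<le> p" and \<theta>: "0 < \<theta>" "\<theta> < 1"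
  obtains C where "0 < C"
    "\<And>x m. x \<in> carr X0 \<Longrightarrow> x \<in> carr X1 \<Longrightarrow> nrm X0 x \<le> m \<Longrightarrow> nrm X1 x \<le> m \<Longrightarrow>
      interp_enorm X0 X1 \<theta> p x \<le> ennreal (C * m)"
proof -
  obtain C where C: "0 \<le> C" "weighted_enorm \<theta> p (\<lambda>t. min 1 t) \<le> ennreal C"
    using weighted_enorm_min_finite[OF p \<theta>] by blast
  have "interp_enorm X0 X1 \<theta> p x \<le> ennreal ((C + 1) * m)"
    if x: "x \<in> carr X0" "x \<in> carr X1" "nrm X0 x \<le> m" "nrm X1 x \<le> m" for x m
  proof -
    have m: "0 \<le> m" using nrm_nonneg[OF X(1) x(1)] x(3) by simp
    have le: "K_functional X0 X1 t x \<le> m * min 1 t" if "0 < t" for t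
    proof -
      have "K_functional X0 X1 t x \<le> m"
        using K_functional_le[OF X x(1) subspace_0[OF subspace_carr[OF X(2)]], of t] that x(3)
        by (simp add: nrm_zero[OF X(2)])
      moreover have "K_functional X0 X1 t x \<le> t * nrm X1 x"
        using K_functional_le[OF X subspace_0[OF subspace_carr[OF X(1)]] x(2), of t] that
        by (simp add: nrm_zero[OF X(1)])
      moreover have "t * nrm X1 x \<le> t * m"
        using x(4) that by (intro mult_left_mono) auto
      ultimately show ?thesis by (simp add: min_def mult.commute)
    qed
    have "weighted_enorm \<theta> p (\<lambda>t. m * min 1 (1 * t)) \<le> ennreal (m * 1 powr \<theta> * C)"
      using C m by (intro weighted_enorm_dilate p) (auto simp: increasing_profile_def)
    then have bound: "weighted_enorm \<theta> p (\<lambda>t. m * min 1 t) \<le> ennreal (m * C)"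
      by simp
    have "interp_enorm X0 X1 \<theta> p x \<le> ennreal (m * C)"
      unfolding interp_enorm_eq using K_functional_nonneg[OF X couple_sumI0[OF X x(1)]] le m C
      by (intro weighted_enorm_mono[OF p _ _ _ bound]) auto
    also have "\<dots> \<le> ennreal ((C + 1) * m)"
      using m by (intro ennreal_leI) (simp add: algebra_simps)
    finally show ?thesis .
  qed
  then show thesis using that[of "C + 1"] C(1) by simp
qed

context
  fixes X0 X1 :: "('v::hausdorff_tvs) nspace" and \<theta> :: real and p :: ennreal
  assumes X0: "embedded_banach X0" and X1: "embedded_banach X1"
    and \<theta>: "0 < \<theta>" "\<theta> < 1" and p: "1 \<le> p"
begin

lemma normed_subspace_real_interp: "normed_subspace (real_interp X0 X1 \<theta> p)"
proof -
  note X = embedded_banachD(1)[OF X0] embedded_banachD(1)[OF X1]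
  let ?E = "real_interp X0 X1 \<theta> p"
  note sums = subspace_couple_sum[OF X]
  have sum: "x \<in> couple_sum X0 X1" if "x \<in> carr ?E" for x
    using that by (simp add: carr_real_interp)
  have add: "x + y \<in> carr ?E \<and> nrm ?E (x + y) \<le> nrm ?E x + nrm ?E y"
    if "x \<in> carr ?E" "y \<in> carr ?E" for x y
  proof -
    have "interp_enorm X0 X1 \<theta> p (x + y) \<le> ennreal (nrm ?E x + nrm ?E y)"
      using that by (intro interp_enorm_add[OF X p] sum interp_enorm_le_nrm nrm_real_interp_nonneg)
    from real_interpI[OF subspace_add[OF sums sum sum] _ this] that show ?thesis
      by (simp add: nrm_real_interp_nonneg)
  qed
  have scale: "c *\<^sub>R x \<in> carr ?E \<and> nrm ?E (c *\<^sub>R x) \<le> \<bar>c\<bar> * nrm ?E x" if "x \<in> carr ?E" for c x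
  proof -
    have "interp_enorm X0 X1 \<theta> p (c *\<^sub>R x) \<le> ennreal (\<bar>c\<bar> * nrm ?E x)"
      using that by (intro interp_enorm_scaleR_le[OF X p] sum interp_enorm_le_nrm nrm_real_interp_nonneg)
    from real_interpI[OF subspace_scale[OF sums sum] _ this] that show ?thesis
      by (simp add: nrm_real_interp_nonneg)
  qed
  have zero: "0 \<in> carr ?E" "nrm ?E 0 = 0"
  proof -
    obtain C where "0 < C" and C: "\<And>x m. x \<in> carr X0 \<Longrightarrow> x \<in> carr X1 \<Longrightarrow> nrm X0 x \<le> m \<Longrightarrow> nrm X1 x \<le> m \<Longrightarrow>
        interp_enorm X0 X1 \<theta> p x \<le> ennreal (C * m)"
      using intersection_subset_real_interp[OF X p \<theta>] by metis
    have "interp_enorm X0 X1 \<theta> p 0 \<le> ennreal 0"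
      using C[of 0 0] subspace_0[OF subspace_carr[OF X(1)]] subspace_0[OF subspace_carr[OF X(2)]]
      by (simp add: nrm_zero[OF X(1)] nrm_zero[OF X(2)])
    from real_interpI[OF subspace_0[OF sums] order_refl this]
    show "0 \<in> carr ?E" "nrm ?E 0 = 0"
      using nrm_real_interp_nonneg[of X0 X1 \<theta> p 0] by auto
  qed
  have eq0: "x = 0" if "x \<in> carr ?E" "nrm ?E x = 0" for x
    using K_functional_growth[OF X p \<theta> sum[OF that(1)] order_refl, of 1] interp_enorm_le_nrm[OF that(1)] that(2)
    by (intro K_functional_zero_imp_zero[OF X0 X1 sum[OF that(1)]]) simp
  have scale_eq: "nrm ?E (c *\<^sub>R x) = \<bar>c\<bar> * nrm ?E x" if x: "x \<in> carr ?E" for c x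
  proof (cases "c = 0")
    case True
    then show ?thesis by (simp add: zero)
  next
    case False
    have "nrm ?E ((1/c) *\<^sub>R (c *\<^sub>R x)) \<le> \<bar>1/c\<bar> * nrm ?E (c *\<^sub>R x)"
      using scale[of "c *\<^sub>R x" "1/c"] scale[OF x] by blast
    then have "\<bar>c\<bar> * nrm ?E x \<le> nrm ?E (c *\<^sub>R x)"
      using False by (simp add: field_simps)
    then show ?thesis using scale[OF x, of c] by linarith
  qed
  show ?thesis
    unfolding normed_subspace_def subspace_def
    using add scale scale_eq zero eq0 nrm_real_interp_nonneg by blast
qed

text \<open>A geometrically dominated series in the interpolation space splits into geometrically
  dominated series in \<open>X0\<close> and \<open>X1\<close>.  Their sums give the limit, and lower semicontinuity of the
  norm turns convergence of the \<open>K_functional\<close> at each \<open>t\<close> into convergence in norm.\<close>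

lemma mcomplete_real_interp:
  "Metric_space.mcomplete (carr (real_interp X0 X1 \<theta> p)) (ndist (real_interp X0 X1 \<theta> p))"
proof (rule mcomplete_if_geometric_series_converge[OF normed_subspace_real_interp])
  note X = embedded_banachD(1)[OF X0] embedded_banachD(1)[OF X1]
  note sums = subspace_couple_sum[OF X]
  let ?E = "real_interp X0 X1 \<theta> p"
  note E = normed_subspace_real_interp
  fix u assume u: "\<And>n. u n \<in> carr ?E" "\<And>n. nrm ?E (u n) \<le> (1/2)^n"
  have sum: "x \<in> couple_sum X0 X1" if "x \<in> carr ?E" for x
    using that by (simp add: carr_real_interp)
  have "\<exists>v w. v \<in> carr X0 \<and> w \<in> carr X1 \<and> u n = v + w \<and> nrm X0 v + 1 * nrm X1 w < 5 * (1/2)^n" for n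
  proof -
    have "K_functional X0 X1 1 (u n) \<le> 4 * 1 powr \<theta> * nrm ?E (u n)"
      by (intro K_functional_growth[OF X p \<theta>] sum interp_enorm_le_nrm nrm_real_interp_nonneg u) simp
    also have "\<dots> < 5 * (1/2)^n"
    proof -
      have "(0::real) < (1/2)^n" by simp
      then show ?thesis using u(2)[of n] unfolding powr_one_eq_one by linarith
    qed
    finally show ?thesis
      using K_functional_splitting[OF X sum[OF u(1)]] by metis
  qed
  then obtain v w where v: "v n \<in> carr X0" and w: "w n \<in> carr X1" and vw: "u n = v n + w n"
    and less: "nrm X0 (v n) + 1 * nrm X1 (w n) < 5 * (1/2)^n" for n
    by metis
  have "nrm X0 (v n) \<le> 5 * (1/2)^n" "nrm X1 (w n) \<le> 5 * (1/2)^n" for n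
    using less[of n] nrm_nonneg[OF X(1) v[of n]] nrm_nonneg[OF X(2) w[of n]] by auto
  then obtain l0 l1 where l0: "l0 \<in> carr X0" "\<And>n. nrm X0 ((\<Sum>i<n. v i) - l0) \<le> 2 * 5 * (1/2)^n"
    and l1: "l1 \<in> carr X1" "\<And>n. nrm X1 ((\<Sum>i<n. w i) - l1) \<le> 2 * 5 * (1/2)^n"
    using geometric_series_converges[OF X(1) embedded_banachD(2)[OF X0], of v 5, OF v]
      geometric_series_converges[OF X(2) embedded_banachD(2)[OF X1], of w 5, OF w] by metis
  define l where "l = l0 + l1"
  define s where "s n = (\<Sum>i<n. u i)" for n
  have sE: "s n \<in> carr ?E" for n
    unfolding s_def by (intro subspace_sum[OF subspace_carr[OF E]] u)
  have s: "s n \<in> couple_sum X0 X1" for n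
    by (rule sum[OF sE])
  have l: "l \<in> couple_sum X0 X1"
    unfolding l_def by (rule couple_sumI[OF X l0(1) l1(1)])
  have small: "(\<lambda>n. c * (1/2)^n) \<longlonglongrightarrow> 0" for c :: real
    by (intro tendsto_mult_right_zero LIMSEQ_power_zero) simp
  have K_lim: "(\<lambda>n. K_functional X0 X1 t (s n - l)) \<longlonglongrightarrow> 0" if t: "0 < t" for t
  proof (rule LIMSEQ_squeeze_zero[OF small])
    have "s n - l = ((\<Sum>i<n. v i) - l0) + ((\<Sum>i<n. w i) - l1)" for n
      by (simp add: s_def l_def vw sum.distrib)
    moreover have "(\<Sum>i<n. v i) - l0 \<in> carr X0" for n
      using v l0(1) by (intro subspace_diff subspace_sum subspace_carr[OF X(1)])
    moreover have "(\<Sum>i<n. w i) - l1 \<in> carr X1" for n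
      using w l1(1) by (intro subspace_diff subspace_sum subspace_carr[OF X(2)])
    ultimately have "K_functional X0 X1 t (s n - l) \<le>
        nrm X0 ((\<Sum>i<n. v i) - l0) + t * nrm X1 ((\<Sum>i<n. w i) - l1)" for n
      using K_functional_le[OF X, of "(\<Sum>i<n. v i) - l0" "(\<Sum>i<n. w i) - l1" t] t by simp
    also have "nrm X0 ((\<Sum>i<n. v i) - l0) + t * nrm X1 ((\<Sum>i<n. w i) - l1) \<le>
        2 * 5 * (1/2)^n + t * (2 * 5 * (1/2)^n)" for n
      using l0(2) l1(2) t by (intro add_mono mult_left_mono) auto
    finally have "K_functional X0 X1 t (s n - l) \<le> 2 * 5 * (1/2)^n + t * (2 * 5 * (1/2)^n)" for n .
    then show "K_functional X0 X1 t (s n - l) \<le> (10 + t * 10) * (1/2)^n" for n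
      by (simp add: distrib_right mult.assoc)
    show "0 \<le> K_functional X0 X1 t (s n - l)" for n
      using K_functional_nonneg[OF X subspace_diff[OF sums s l]] t by simp
  qed
  have tail: "interp_enorm X0 X1 \<theta> p (s n - l) \<le> ennreal (2 * (1/2)^n)" for n
    unfolding interp_enorm_eq
  proof (rule weighted_enorm_limit[OF p])
    show "increasing_profile (\<lambda>t. K_functional X0 X1 t (s n - s (m + n)))" for m
      by (intro increasing_profile_K_functional[OF X] subspace_diff[OF sums] s)
    show "(\<lambda>m. K_functional X0 X1 t (s n - s (m + n))) \<longlonglongrightarrow> K_functional X0 X1 t (s n - l)" if "0 < t" for t
    proof (rule LIM_zero_cancel, rule Lim_null_comparison)
      have "norm (K_functional X0 X1 t (s n - s (m + n)) - K_functional X0 X1 t (s n - l)) \<le>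
          K_functional X0 X1 t (s (m + n) - l)" for m
      proof -
        have d: "s n - l \<in> couple_sum X0 X1" "s n - s (m + n) \<in> couple_sum X0 X1"
          by (intro subspace_diff[OF sums] s l)+
        have "s n - l - (s n - s (m + n)) = s (m + n) - l" by simp
        then show ?thesis
          using K_functional_diff_le[OF X d, of t] that by (simp add: abs_minus_commute)
      qed
      then show "\<forall>\<^sub>F m in sequentially.
          norm (K_functional X0 X1 t (s n - s (m + n)) - K_functional X0 X1 t (s n - l)) \<le>
          K_functional X0 X1 t (s (m + n) - l)"
        by simp
      show "(\<lambda>m. K_functional X0 X1 t (s (m + n) - l)) \<longlonglongrightarrow> 0"
        by (rule LIMSEQ_ignore_initial_segment[OF K_lim[OF that]])
    qed
    show "weighted_enorm \<theta> p (\<lambda>t. K_functional X0 X1 t (s n - s (m + n))) \<le> ennreal (2 * (1/2)^n)" for m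
    proof -
      have "nrm ?E (s n - s (m + n)) \<le> 2 * 1 * (1/2)^n"
        using geometric_partial_sums_diff_le[OF E, of u 1 n "m + n"] u(1) u(2)
          nrm_minus_commute[OF E sE sE, of n "m + n"] by (simp add: s_def)
      then show ?thesis
        using interp_enorm_le_nrm[OF subspace_diff[OF subspace_carr[OF E] sE sE], of n "m + n"]
        by (auto simp: interp_enorm_eq elim!: order_trans intro!: ennreal_leI)
    qed
  qed simp
  have diff: "s n - l \<in> carr ?E" "nrm ?E (s n - l) \<le> 2 * (1/2)^n" for n
    by (rule real_interpI[OF subspace_diff[OF sums s l] _ tail]; simp)+
  have "l = s 0 - (s 0 - l)" by simp
  then have "l \<in> carr ?E"
    using subspace_diff[OF subspace_carr[OF E] sE diff(1)] by metis
  moreover have "(\<lambda>n. nrm ?E (s n - l)) \<longlonglongrightarrow> 0"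
    by (rule LIMSEQ_squeeze_zero[OF small[of 2] nrm_real_interp_nonneg diff(2)])
  ultimately show "\<exists>l\<in>carr ?E. (\<lambda>n. nrm ?E ((\<Sum>i<n. u i) - l)) \<longlonglongrightarrow> 0"
    unfolding s_def by blast
qed

end

section \<open>Total boundedness\<close>

text \<open>The centres of the given balls need not lie in \<open>S\<close>; halving the radius leaves room to move
  them into \<open>S\<close>.\<close>

lemma (in Metric_space) mtotally_bounded_if_nets:
  assumes net: "\<And>\<epsilon>. 0 < \<epsilon> \<Longrightarrow> \<exists>F. finite F \<and> S \<subseteq> (\<Union>f\<in>F. mball f \<epsilon>)"
  shows "mtotally_bounded S"
  unfolding mtotally_bounded_def
proof (intro allI impI)
  fix \<epsilon> :: real assume "0 < \<epsilon>"
  then have "0 < \<epsilon>/2" by simp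
  from net[OF this] obtain F where F: "finite F" "S \<subseteq> (\<Union>f\<in>F. mball f (\<epsilon>/2))"
    by blast
  define F' where "F' = {f \<in> F. S \<inter> mball f (\<epsilon>/2) \<noteq> {}}"
  define c where "c f = (SOME x. x \<in> S \<inter> mball f (\<epsilon>/2))" for f
  have c: "c f \<in> S \<inter> mball f (\<epsilon>/2)" if "f \<in> F'" for f
  proof -
    have "\<exists>x. x \<in> S \<inter> mball f (\<epsilon>/2)"
      using that by (auto simp: F'_def)
    then show ?thesis
      unfolding c_def by (rule someI_ex)
  qed
  have "S \<subseteq> (\<Union>x\<in>c ` F'. mball x \<epsilon>)"
  proof
    fix x assume x: "x \<in> S"
    then obtain f where f: "f \<in> F" "x \<in> mball f (\<epsilon>/2)"
      using F by blast
    with x have "f \<in> F'" by (auto simp: F'_def)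
    with c[OF this] f have "x \<in> mball (c f) \<epsilon>"
      using triangle[of "c f" f x] commute[of f "c f"] by auto
    with \<open>f \<in> F'\<close> show "x \<in> (\<Union>x\<in>c ` F'. mball x \<epsilon>)" by blast
  qed
  then show "\<exists>K. finite K \<and> K \<subseteq> S \<and> S \<subseteq> (\<Union>x\<in>K. mball x \<epsilon>)"
    using F c by (intro exI[of _ "c ` F'"]) (auto simp: F'_def)
qed

text \<open>Products \<open>l *\<^sub>R f\<close> of a net of \<open>{0..N}\<close> and a net of \<open>K\<close> form a net, provided that the mesh
  of the first is fine compared with a bound \<open>b\<close> for the norms occurring in the second.\<close>

lemma scaled_compact_finite_net:
  assumes X: "normed_subspace X" and K: "compactin (ntopology X) K" and N: "0 \<le> N" and \<epsilon>: "0 < \<epsilon>"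
  obtains G where "finite G" "G \<subseteq> carr X"
    "\<And>s k. 0 \<le> s \<Longrightarrow> s \<le> N \<Longrightarrow> k \<in> K \<Longrightarrow> \<exists>g\<in>G. nrm X (s *\<^sub>R k - g) < \<epsilon>"
proof -
  interpret Metric_space "carr X" "ndist X"
    by (rule normed_subspace_Metric_space[OF X])
  note sub = subspace_carr[OF X]
  have KX: "K \<subseteq> carr X"
    using compactin_subset_topspace[OF K] by simp
  define e where "e = \<epsilon> / (2 * (N + 1))"
  have e: "0 < e" using \<epsilon> N by (simp add: e_def)
  obtain F where F: "finite F" "F \<subseteq> K" "K \<subseteq> (\<Union>f\<in>F. mball f e)"
    using compactin_imp_mtotally_bounded[OF K] e unfolding mtotally_bounded_def by metis
  define b where "b = 1 + (\<Sum>f\<in>F. nrm X f)"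
  have nF: "0 \<le> nrm X f" if "f \<in> F" for f
    using that F KX nrm_nonneg[OF X] by blast
  then have b: "0 < b" "nrm X f \<le> b" if "f \<in> F" for f
    using that F(1) member_le_sum[of f F "nrm X"] sum_nonneg[of F "nrm X"] by (auto simp: b_def)
  have b0: "0 < b"
    using nF sum_nonneg[of F "nrm X"] by (auto simp: b_def)
  have "0 < \<epsilon> / (2 * b)"
    using b0 \<epsilon> by simp
  with compact_Icc[of 0 N] obtain L where L: "finite L" "{0..N} \<subseteq> (\<Union>l\<in>L. ball l (\<epsilon> / (2 * b)))"
    unfolding compact_eq_totally_bounded by blast
  show thesis
  proof
    show "finite ((\<lambda>(l, f). l *\<^sub>R f) ` (L \<times> F))"
      using L F by simp
    show "(\<lambda>(l, f). l *\<^sub>R f) ` (L \<times> F) \<subseteq> carr X"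
      using F KX subspace_scale[OF sub] by auto
    fix s :: real and k assume s: "0 \<le> s" "s \<le> N" and k: "k \<in> K"
    obtain l where l: "l \<in> L" "\<bar>s - l\<bar> < \<epsilon> / (2 * b)"
      using L s by (force simp: dist_real_def)
    obtain f where f: "f \<in> F" "k \<in> mball f e"
      using F k by blast
    have fX: "f \<in> carr X" and kX: "k \<in> carr X" using f F KX k by auto
    have kf: "nrm X (k - f) < e"
      using f(2) fX kX nrm_minus_commute[OF X] by (simp add: ndist_def)
    have "s *\<^sub>R k - l *\<^sub>R f = s *\<^sub>R (k - f) + (s - l) *\<^sub>R f"
      by (simp add: algebra_simps)
    then have "nrm X (s *\<^sub>R k - l *\<^sub>R f) \<le> nrm X (s *\<^sub>R (k - f)) + nrm X ((s - l) *\<^sub>R f)"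
      using nrm_add_le[OF X, of "s *\<^sub>R (k - f)" "(s - l) *\<^sub>R f"] fX kX
        subspace_scale[OF sub] subspace_diff[OF sub] by simp
    also have "\<dots> = s * nrm X (k - f) + \<bar>s - l\<bar> * nrm X f"
      using s fX kX subspace_diff[OF sub] by (simp add: nrm_scaleR[OF X])
    also have "\<dots> \<le> N * e + \<epsilon> / (2 * b) * b"
      using s kf l b[OF f(1)] e nF[OF f(1)] nrm_nonneg[OF X subspace_diff[OF sub kX fX]]
      by (intro add_mono mult_mono) auto
    also have "\<dots> < \<epsilon>"
      using b0 N \<epsilon> by (simp add: e_def field_simps)
    finally show "\<exists>g\<in>(\<lambda>(l, f). l *\<^sub>R f) ` (L \<times> F). nrm X (s *\<^sub>R k - g) < \<epsilon>"
      using l(1) f(1) by force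
  qed
qed

section \<open>Compactness of the interpolated map\<close>

text \<open>Limits in \<open>X\<close> and in \<open>Y\<close> are limits in the ambient space, so an operator bounded on \<open>X\<close>
  with values in \<open>Y\<close> has a closed graph as a map from \<open>X\<close> to \<open>Y\<close>.\<close>

lemma bounded_into_embedded_subspace:
  assumes X: "embedded_banach X" and Y: "embedded_banach Y"
    and P: "linear_between (carr X) (carr X \<inter> carr Y) P"
    and c: "\<And>x. x \<in> carr X \<Longrightarrow> nrm X (P x) \<le> c * nrm X x"
  obtains M where "0 < M" "\<And>x. x \<in> carr X \<Longrightarrow> nrm Y (P x) \<le> M * nrm X x"
proof (rule closed_graph_bounded[of X Y P])
  note nX = embedded_banachD(1)[OF X]
  have PX: "linear_between (carr X) (carr X) P" and PY: "linear_between (carr X) (carr Y) P"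
    using P by (auto simp: linear_between_def)
  then show "linear_between (carr X) (carr Y) P" by simp
  note in_X = linear_between_in[OF PX] and in_Y = linear_between_in[OF PY]
  note diff = linear_between_diff[OF PX subspace_carr[OF nX]]
  fix x :: "nat \<Rightarrow> 'a" and l y
  assume x: "\<And>n. x n \<in> carr X" and l: "l \<in> carr X" and y: "y \<in> carr Y"
    and xl: "(\<lambda>n. nrm X (x n - l)) \<longlonglongrightarrow> 0" and Py: "(\<lambda>n. nrm Y (P (x n) - y)) \<longlonglongrightarrow> 0"
  have d: "x n - l \<in> carr X" for n
    by (rule subspace_diff[OF subspace_carr[OF nX] x l])
  have "(\<lambda>n. nrm X (P (x n) - P l)) \<longlonglongrightarrow> 0"
  proof (rule LIMSEQ_squeeze_zero)
    show "(\<lambda>n. c * nrm X (x n - l)) \<longlonglongrightarrow> 0"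
      using tendsto_mult_right_zero[OF xl] .
    show "0 \<le> nrm X (P (x n) - P l)" "nrm X (P (x n) - P l) \<le> c * nrm X (x n - l)" for n
      using c[OF d] nrm_nonneg[OF nX in_X[OF d]] by (simp_all add: diff[OF x l])
  qed
  then have "(\<lambda>n. P (x n)) \<longlonglongrightarrow> P l"
    by (intro embedded_banach_tendsto[OF X] in_X x l)
  moreover have "(\<lambda>n. P (x n)) \<longlonglongrightarrow> y"
    using Py by (intro embedded_banach_tendsto[OF Y] in_Y x y)
  ultimately show "P l = y"
    by (rule LIMSEQ_unique)
qed (use embedded_banachD[OF X] embedded_banachD[OF Y] that in auto)

context
  fixes A0 A1 :: "('v::hausdorff_tvs) nspace" and B0 B1 :: "('w::hausdorff_tvs) nspace"
    and T :: "'v \<Rightarrow> 'w" and C1 :: real and K :: "'w set" and \<theta> :: real and p :: ennreal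
  assumes A: "normed_subspace A0" "normed_subspace A1" and B: "embedded_banach B0" "embedded_banach B1"
    and A01: "carr A0 \<subseteq> carr A1"
    and T1: "T ` carr A1 \<subseteq> carr B1" and T0: "T ` carr A0 \<subseteq> carr B0"
    and C1: "0 < C1"
    and Lipschitz: "\<And>a a'. a \<in> carr A1 \<Longrightarrow> a' \<in> carr A1 \<Longrightarrow> nrm B1 (T a - T a') \<le> C1 * nrm A1 (a - a')"
    and K: "compactin (ntopology B0) K"
    and TK: "\<And>a. a \<in> carr A0 \<Longrightarrow> T a \<in> (\<lambda>k. nrm A0 a *\<^sub>R k) ` K"
    and \<theta>: "0 < \<theta>" "\<theta> < 1" and p: "1 \<le> p"
begin

text \<open>The operators of property (H), with their common constant \<open>c\<close>.\<close>

definition smoothing :: "real \<Rightarrow> ('w \<Rightarrow> 'w) \<Rightarrow> bool" where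
  "smoothing c P \<longleftrightarrow> linear_between (couple_sum B0 B1) (carr B0 \<inter> carr B1) P \<and>
     (\<forall>b\<in>carr B0. nrm B0 (P b) \<le> c * nrm B0 b) \<and> (\<forall>b\<in>carr B1. nrm B1 (P b) \<le> c * nrm B1 b)"

lemmas nB = embedded_banachD(1)[OF B(1)] embedded_banachD(1)[OF B(2)]
lemmas subB0 = subspace_carr[OF nB(1)] and subB1 = subspace_carr[OF nB(2)]
lemmas B0_sum = couple_sumI0[OF nB] and B1_sum = couple_sumI1[OF nB]

lemma smoothing_diff:
  assumes P: "smoothing c P" and x: "x \<in> couple_sum B0 B1" and y: "y \<in> couple_sum B0 B1"
  shows "P (x - y) = P x - P y"
  using linear_between_diff[OF _ subspace_couple_sum[OF nB] x y] P unfolding smoothing_def by blast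

lemma smoothing_in:
  assumes "smoothing c P" "x \<in> couple_sum B0 B1"
  shows "P x \<in> carr B0" "P x \<in> carr B1"
  using assms by (auto simp: smoothing_def linear_between_def)

text \<open>In a splitting \<open>a = a0 + a1\<close> the error \<open>T a - P (T a)\<close> splits into the errors of
  \<open>T a0\<close>, small in \<open>B0\<close> by the choice of \<open>P\<close>, and of \<open>T a - T a0\<close>, bounded in \<open>B1\<close> by the
  Lipschitz condition.  The factor \<open>\<epsilon>\<close> survives interpolation to the power \<open>1 - \<theta>\<close>.\<close>

lemma smoothing_error:
  assumes P: "smoothing c P" and c: "0 < c" and \<epsilon>: "0 < \<epsilon>" and PK: "\<And>k. k \<in> K \<Longrightarrow> nrm B0 (P k - k) < \<epsilon>"
    and a: "a \<in> carr A1" and m: "0 \<le> m" "interp_enorm A0 A1 \<theta> p a \<le> ennreal m"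
  shows "T a - P (T a) \<in> couple_sum B0 B1"
    "interp_enorm B0 B1 \<theta> p (T a - P (T a)) \<le> ennreal (\<epsilon> * ((1 + c) * C1 / \<epsilon>) powr \<theta> * m)"
proof -
  note sums = subspace_couple_sum[OF nB]
  have a_sum: "a \<in> couple_sum A0 A1"
    by (rule couple_sumI1[OF A a])
  have Ta: "T a \<in> carr B1" using T1 a by blast
  show y: "T a - P (T a) \<in> couple_sum B0 B1"
    using B1_sum[OF Ta] B1_sum[OF smoothing_in(2)[OF P B1_sum[OF Ta]]] by (rule subspace_diff[OF sums])
  show "interp_enorm B0 B1 \<theta> p (T a - P (T a)) \<le> ennreal (\<epsilon> * ((1 + c) * C1 / \<epsilon>) powr \<theta> * m)"
  proof (rule interp_enorm_dominated[OF A nB p a_sum y _ _ _ m])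
    fix t :: real assume t: "0 < t"
    show "K_functional B0 B1 t (T a - P (T a)) \<le> \<epsilon> * K_functional A0 A1 ((1 + c) * C1 / \<epsilon> * t) a"
    proof (rule K_functional_greatest[OF A a_sum \<epsilon>])
      fix a0 a1 assume a0: "a0 \<in> carr A0" and a1: "a1 \<in> carr A1" and split: "a = a0 + a1"
      have a01: "a0 \<in> carr A1" using a0 A01 by blast
      have Ta0: "T a0 \<in> carr B0" "T a0 \<in> carr B1" using T0 T1 a0 a01 by auto
      define d where "d = T a - T a0"
      have d: "d \<in> carr B1"
        unfolding d_def by (rule subspace_diff[OF subB1 Ta Ta0(2)])
      obtain k where k: "k \<in> K" "T a0 = nrm A0 a0 *\<^sub>R k"
        using TK[OF a0] by blast
      have kB: "k \<in> carr B0"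
        using k compactin_subset_topspace[OF K] Metric_space.topspace_mtopology[OF normed_subspace_Metric_space[OF nB(1)]]
        by auto
      have Pk: "P k \<in> carr B0" "P (T a0) \<in> carr B0" "P d \<in> carr B1"
        using smoothing_in[OF P] B0_sum B1_sum kB Ta0 d by blast+
      have "P (T a0) = nrm A0 a0 *\<^sub>R P k"
        using P linear_between_scaleR[OF _ B0_sum[OF kB]] unfolding k(2) smoothing_def by blast
      then have "nrm B0 (T a0 - P (T a0)) = nrm B0 (nrm A0 a0 *\<^sub>R (k - P k))"
        by (simp add: k(2) scaleR_right_diff_distrib)
      also have "\<dots> = nrm A0 a0 * nrm B0 (P k - k)"
        using nrm_scaleR[OF nB(1) subspace_diff[OF subB0 kB Pk(1)]] nrm_minus_commute[OF nB(1) kB Pk(1)]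
          nrm_nonneg[OF A(1) a0] by simp
      also have "\<dots> \<le> nrm A0 a0 * \<epsilon>"
        using PK[OF k(1)] nrm_nonneg[OF A(1) a0] by (intro mult_left_mono) auto
      finally have in0: "nrm B0 (T a0 - P (T a0)) \<le> nrm A0 a0 * \<epsilon>" .
      have "nrm B1 (d - P d) \<le> nrm B1 d + c * nrm B1 d"
        using nrm_diff_le[OF nB(2) d Pk(3)] P d by (force simp: smoothing_def)
      also have "\<dots> = (1 + c) * nrm B1 d" by (simp add: distrib_right)
      also have "\<dots> \<le> (1 + c) * (C1 * nrm A1 a1)"
        using Lipschitz[OF a a01] c by (intro mult_left_mono) (auto simp: d_def split)
      finally have in1: "nrm B1 (d - P d) \<le> (1 + c) * (C1 * nrm A1 a1)" .
      have "T a - P (T a) = (T a0 - P (T a0)) + (d - P d)"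
        using smoothing_diff[OF P B1_sum[OF Ta] B1_sum[OF Ta0(2)]] by (simp add: d_def)
      then have "K_functional B0 B1 t (T a - P (T a)) \<le> nrm B0 (T a0 - P (T a0)) + t * nrm B1 (d - P d)"
        using K_functional_le[OF nB subspace_diff[OF subB0 Ta0(1) Pk(2)] subspace_diff[OF subB1 d Pk(3)], of t] t
        by simp
      also have "\<dots> \<le> nrm A0 a0 * \<epsilon> + t * ((1 + c) * (C1 * nrm A1 a1))"
        using in0 in1 t by (intro add_mono mult_left_mono) auto
      also have "\<dots> = \<epsilon> * (nrm A0 a0 + (1 + c) * C1 / \<epsilon> * t * nrm A1 a1)"
        using \<epsilon> by (simp add: field_simps)
      finally show "K_functional B0 B1 t (T a - P (T a)) \<le>
          \<epsilon> * (nrm A0 a0 + (1 + c) * C1 / \<epsilon> * t * nrm A1 a1)" .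
    qed
  qed (use \<epsilon> c C1 in auto)
qed

text \<open>\<open>P\<close> is bounded from \<open>B0\<close> and from \<open>B1\<close> into \<open>B0 \<inter> B1\<close>.  For large \<open>t\<close> a nearly optimal
  splitting \<open>a = a0 + a1\<close> has \<open>a1\<close> uniformly small in \<open>A1\<close>, so \<open>P (T a)\<close> is uniformly close to
  \<open>P (T a0)\<close>, and \<open>T a0\<close> lies in the compact set of all \<open>s *\<^sub>R k\<close> with \<open>0 \<le> s \<le> N\<close> and
  \<open>k \<in> K\<close>.\<close>

lemma smoothed_image_finite_net:
  assumes P: "smoothing c P" and m: "0 \<le> m" and \<eta>: "0 < \<eta>"
  obtains F where "finite F" "F \<subseteq> carr B0 \<inter> carr B1"
    "\<And>a. a \<in> carr A1 \<Longrightarrow> interp_enorm A0 A1 \<theta> p a \<le> ennreal m \<Longrightarrow>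
      \<exists>f\<in>F. interp_enorm B0 B1 \<theta> p (P (T a) - f) \<le> ennreal \<eta>"
proof -
  have P0: "linear_between (carr B0) (carr B0 \<inter> carr B1) P" and P1: "linear_between (carr B1) (carr B1 \<inter> carr B0) P"
    using P B0_sum B1_sum by (auto simp: smoothing_def linear_between_def)
  have c0: "\<And>b. b \<in> carr B0 \<Longrightarrow> nrm B0 (P b) \<le> c * nrm B0 b"
    and c1: "\<And>b. b \<in> carr B1 \<Longrightarrow> nrm B1 (P b) \<le> c * nrm B1 b"
    using P by (auto simp: smoothing_def)
  obtain M0 where M0: "\<And>b. b \<in> carr B0 \<Longrightarrow> nrm B1 (P b) \<le> M0 * nrm B0 b"
    using bounded_into_embedded_subspace[OF B P0 c0] by metis
  obtain M1 where M1: "\<And>b. b \<in> carr B1 \<Longrightarrow> nrm B0 (P b) \<le> M1 * nrm B1 b"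
    using bounded_into_embedded_subspace[OF B(2,1) P1 c1] by metis
  define M where "M = max 1 (max c (max M0 M1))"
  have M: "0 < M" "c \<le> M" "M0 \<le> M" "M1 \<le> M" by (auto simp: M_def)
  have from0: "nrm B0 (P b) \<le> M * nrm B0 b" "nrm B1 (P b) \<le> M * nrm B0 b" if "b \<in> carr B0" for b
    using c0[OF that] M0[OF that] mult_right_mono[OF M(2) nrm_nonneg[OF nB(1) that]]
      mult_right_mono[OF M(3) nrm_nonneg[OF nB(1) that]] by linarith+
  have from1: "nrm B0 (P b) \<le> M * nrm B1 b" "nrm B1 (P b) \<le> M * nrm B1 b" if "b \<in> carr B1" for b
    using c1[OF that] M1[OF that] mult_right_mono[OF M(2) nrm_nonneg[OF nB(2) that]]
      mult_right_mono[OF M(4) nrm_nonneg[OF nB(2) that]] by linarith+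
  obtain C where C: "0 < C" and inter: "\<And>x m. x \<in> carr B0 \<Longrightarrow> x \<in> carr B1 \<Longrightarrow> nrm B0 x \<le> m \<Longrightarrow>
      nrm B1 x \<le> m \<Longrightarrow> interp_enorm B0 B1 \<theta> p x \<le> ennreal (C * m)"
    using intersection_subset_real_interp[OF nB p \<theta>] by metis
  \<comment> \<open>Two errors of size \<open>\<delta>\<close>, each enlarged by \<open>M\<close> under \<open>P\<close> and by \<open>C\<close> under the embedding of the
    intersection, add up to \<open>\<eta>\<close>.\<close>
  define \<delta> where "\<delta> = \<eta> / (2 * C * M)"
  have \<delta>: "0 < \<delta>" using \<eta> C M by (simp add: \<delta>_def)
  \<comment> \<open>\<open>K(t, a) < t\<^sup>\<theta> (4 m + 1)\<close>, so the second part of a splitting has norm below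
    \<open>t\<^bsup>\<theta> - 1\<^esup> (4 m + 1)\<close>; this \<open>t\<close> makes that bound equal to \<open>\<delta> / C1\<close>.\<close>
  define t where "t = (\<delta> / (C1 * (4 * m + 1))) powr (1 / (\<theta> - 1))"
  have t: "0 < t" and t_powr: "t powr (\<theta> - 1) * (C1 * (4 * m + 1)) = \<delta>"
    using \<delta> C1 m \<theta> by (simp_all add: t_def powr_powr)
  define N where "N = t powr \<theta> * (4 * m + 1)"
  have N: "0 \<le> N" using m by (simp add: N_def)
  obtain G where G: "finite G" "G \<subseteq> carr B0"
    "\<And>s k. 0 \<le> s \<Longrightarrow> s \<le> N \<Longrightarrow> k \<in> K \<Longrightarrow> \<exists>g\<in>G. nrm B0 (s *\<^sub>R k - g) < \<delta>"
    using scaled_compact_finite_net[OF nB(1) K N \<delta>] by metis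
  show thesis
  proof
    show "finite (P ` G)" using G by simp
    show "P ` G \<subseteq> carr B0 \<inter> carr B1"
      using G smoothing_in[OF P B0_sum] by blast
    fix a assume a: "a \<in> carr A1" and am: "interp_enorm A0 A1 \<theta> p a \<le> ennreal m"
    have a_sum: "a \<in> couple_sum A0 A1"
      by (rule couple_sumI1[OF A a])
    have "K_functional A0 A1 t a \<le> 4 * t powr \<theta> * m"
      by (rule K_functional_growth[OF A p \<theta> a_sum m am t])
    also have "\<dots> < N"
      using t by (simp add: N_def algebra_simps)
    finally obtain a0 a1 where a0: "a0 \<in> carr A0" and a1: "a1 \<in> carr A1" and split: "a = a0 + a1"
      and less: "nrm A0 a0 + t * nrm A1 a1 < N"
      by (rule K_functional_splitting[OF A a_sum])
    have a01: "a0 \<in> carr A1" using a0 A01 by blast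
    have nn: "0 \<le> nrm A0 a0" "0 \<le> nrm A1 a1"
      using nrm_nonneg A a0 a1 by blast+
    have "0 \<le> t * nrm A1 a1" using t nn by simp
    then have a0N: "nrm A0 a0 \<le> N" using less by linarith
    have "t * nrm A1 a1 \<le> N" using less nn by linarith
    then have "nrm A1 a1 \<le> t powr (\<theta> - 1) * (4 * m + 1)"
      using t by (simp add: N_def powr_diff field_simps)
    then have "C1 * nrm A1 a1 \<le> C1 * (t powr (\<theta> - 1) * (4 * m + 1))"
      using C1 by (intro mult_left_mono) auto
    then have small: "C1 * nrm A1 a1 \<le> \<delta>"
      using t_powr by (simp add: mult.left_commute)
    have Ta: "T a \<in> carr B1" "T a0 \<in> carr B0" "T a0 \<in> carr B1"
      using T0 T1 a a0 a01 by auto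
    obtain k where k: "k \<in> K" "T a0 = nrm A0 a0 *\<^sub>R k"
      using TK[OF a0] by blast
    obtain g where g: "g \<in> G" "nrm B0 (T a0 - g) < \<delta>"
      using G(3)[OF nn(1) a0N k(1)] k(2) by auto
    have gB: "g \<in> carr B0" using g G by blast
    define d where "d = T a - T a0"
    define e where "e = T a0 - g"
    have d: "d \<in> carr B1" "nrm B1 d \<le> \<delta>"
      using subspace_diff[OF subB1 Ta(1,3)] Lipschitz[OF a a01] small by (auto simp: d_def split)
    have e: "e \<in> carr B0" "nrm B0 e \<le> \<delta>"
      using subspace_diff[OF subB0 Ta(2) gB] g by (auto simp: e_def)
    have eq: "P (T a) - P g = P d + P e"
      using smoothing_diff[OF P B1_sum[OF Ta(1)] B0_sum[OF Ta(2)]] smoothing_diff[OF P B0_sum[OF Ta(2)] B0_sum[OF gB]]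
      by (simp add: d_def e_def)
    note in_d = smoothing_in[OF P B1_sum[OF d(1)]] and in_e = smoothing_in[OF P B0_sum[OF e(1)]]
    have "M * nrm B1 d \<le> M * \<delta>" "M * nrm B0 e \<le> M * \<delta>"
      using M d e by (auto intro!: mult_left_mono)
    then have "nrm B0 (P d + P e) \<le> 2 * M * \<delta>" "nrm B1 (P d + P e) \<le> 2 * M * \<delta>"
      using nrm_add_le[OF nB(1) in_d(1) in_e(1)] nrm_add_le[OF nB(2) in_d(2) in_e(2)]
        from0[OF e(1)] from1[OF d(1)] by linarith+
    then have "interp_enorm B0 B1 \<theta> p (P d + P e) \<le> ennreal (C * (2 * M * \<delta>))"
      using subspace_add[OF subB0 in_d(1) in_e(1)] subspace_add[OF subB1 in_d(2) in_e(2)]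
      by (intro inter)
    also have "C * (2 * M * \<delta>) = \<eta>"
      using C M by (simp add: \<delta>_def)
    finally show "\<exists>f\<in>P ` G. interp_enorm B0 B1 \<theta> p (P (T a) - f) \<le> ennreal \<eta>"
      using g(1) unfolding eq[symmetric] by blast
  qed
qed

lemma image_finite_net:
  assumes H: "property_H B0 B1" and m: "0 \<le> m" and \<eta>: "0 < \<eta>"
  obtains F where "finite F" "F \<subseteq> carr (real_interp B0 B1 \<theta> p)"
    "\<And>a. a \<in> carr A1 \<Longrightarrow> interp_enorm A0 A1 \<theta> p a \<le> ennreal m \<Longrightarrow>
      T a \<in> carr (real_interp B0 B1 \<theta> p) \<and> (\<exists>f\<in>F. nrm (real_interp B0 B1 \<theta> p) (T a - f) \<le> \<eta>)"
proof -
  let ?E = "real_interp B0 B1 \<theta> p"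
  note sums = subspace_couple_sum[OF nB]
  note E = normed_subspace_real_interp[OF B \<theta> p]
  obtain c \<D> where c: "0 < c" and "\<forall>P\<in>\<D>. smoothing c P"
    and D: "\<forall>\<epsilon>>0. \<exists>P\<in>\<D>. \<forall>b\<in>K. nrm B0 (P b - b) < \<epsilon>"
    using H K unfolding property_H_def smoothing_def by metis
  then have approx: "\<exists>P. smoothing c P \<and> (\<forall>k\<in>K. nrm B0 (P k - k) < \<epsilon>)" if "0 < \<epsilon>" for \<epsilon>
    using that by blast
  \<comment> \<open>The error bound equals \<open>\<epsilon> powr (1 - \<theta>)\<close> times a constant below \<open>q\<close>; adding \<open>1\<close> keeps \<open>q\<close>
    positive when \<open>m = 0\<close>.\<close>
  define q where "q = ((1 + c) * C1) powr \<theta> * m + 1"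
  have q: "0 < q" using m by (simp add: q_def add_nonneg_pos)
  define \<epsilon> where "\<epsilon> = (\<eta> / 2 / q) powr (1 / (1 - \<theta>))"
  have \<epsilon>: "0 < \<epsilon>" and \<epsilon>_powr: "\<epsilon> powr (1 - \<theta>) * q = \<eta> / 2"
    using \<eta> q \<theta> by (simp_all add: \<epsilon>_def powr_powr)
  obtain P where P: "smoothing c P" and PK: "\<And>k. k \<in> K \<Longrightarrow> nrm B0 (P k - k) < \<epsilon>"
    using approx[OF \<epsilon>] by blast
  have "\<epsilon> * ((1 + c) * C1 / \<epsilon>) powr \<theta> * m = \<epsilon> powr (1 - \<theta>) * (((1 + c) * C1) powr \<theta> * m)"
    using \<epsilon> c C1 by (simp add: powr_divide powr_diff)
  also have "\<dots> \<le> \<epsilon> powr (1 - \<theta>) * q"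
    by (intro mult_left_mono) (auto simp: q_def)
  finally have error: "\<epsilon> * ((1 + c) * C1 / \<epsilon>) powr \<theta> * m \<le> \<eta> / 2"
    using \<epsilon>_powr by simp
  obtain F where F: "finite F" "F \<subseteq> carr B0 \<inter> carr B1"
    and net: "\<And>a. a \<in> carr A1 \<Longrightarrow> interp_enorm A0 A1 \<theta> p a \<le> ennreal m \<Longrightarrow>
      \<exists>f\<in>F. interp_enorm B0 B1 \<theta> p (P (T a) - f) \<le> ennreal (\<eta> / 2)"
    using smoothed_image_finite_net[OF P m, of "\<eta> / 2"] \<eta> by (metis half_gt_zero)
  obtain C where "0 < C" and inter: "\<And>x m. x \<in> carr B0 \<Longrightarrow> x \<in> carr B1 \<Longrightarrow> nrm B0 x \<le> m \<Longrightarrow>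
      nrm B1 x \<le> m \<Longrightarrow> interp_enorm B0 B1 \<theta> p x \<le> ennreal (C * m)"
    using intersection_subset_real_interp[OF nB p \<theta>] by metis
  have FE: "F \<subseteq> carr ?E"
  proof
    fix f assume "f \<in> F"
    then have f: "f \<in> carr B0" "f \<in> carr B1" using F by auto
    define n where "n = max (nrm B0 f) (nrm B1 f)"
    have "0 \<le> C * n"
      using \<open>0 < C\<close> nrm_nonneg[OF nB(1) f(1)] by (simp add: n_def)
    moreover have "interp_enorm B0 B1 \<theta> p f \<le> ennreal (C * n)"
      by (rule inter) (use f in \<open>auto simp: n_def\<close>)
    ultimately show "f \<in> carr ?E"
      by (rule real_interpI(1)[OF B0_sum[OF f(1)]])
  qed
  show thesis
  proof (rule that[OF F(1) FE])
    fix a assume a: "a \<in> carr A1" and am: "interp_enorm A0 A1 \<theta> p a \<le> ennreal m"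
    obtain f where f: "f \<in> F" and Pf: "interp_enorm B0 B1 \<theta> p (P (T a) - f) \<le> ennreal (\<eta> / 2)"
      using net[OF a am] by blast
    have fB: "f \<in> carr B0" using f F by blast
    have Ta: "T a \<in> carr B1" using T1 a by blast
    have "interp_enorm B0 B1 \<theta> p (T a - P (T a)) \<le> ennreal (\<eta> / 2)"
      by (rule order_trans[OF smoothing_error(2)[OF P c \<epsilon> PK a m am] ennreal_leI[OF error]])
    moreover have "P (T a) - f \<in> couple_sum B0 B1"
      by (intro subspace_diff[OF sums] B0_sum fB smoothing_in(1)[OF P B1_sum[OF Ta]])
    ultimately have "interp_enorm B0 B1 \<theta> p ((T a - P (T a)) + (P (T a) - f)) \<le> ennreal (\<eta> / 2 + \<eta> / 2)"
      using Pf \<eta> by (intro interp_enorm_add[OF nB p] smoothing_error(1)[OF P c \<epsilon> PK a m am]) auto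
    then have "interp_enorm B0 B1 \<theta> p (T a - f) \<le> ennreal \<eta>"
      by simp
    from real_interpI[OF subspace_diff[OF sums B1_sum[OF Ta] B0_sum[OF fB]] _ this] \<eta>
    have diff: "T a - f \<in> carr ?E" "nrm ?E (T a - f) \<le> \<eta>" by auto
    moreover have "T a \<in> carr ?E"
      using subspace_add[OF subspace_carr[OF E] diff(1), of f] FE f by auto
    ultimately show "T a \<in> carr ?E \<and> (\<exists>f\<in>F. nrm ?E (T a - f) \<le> \<eta>)"
      using f by blast
  qed
qed

lemma image_relatively_compact:
  assumes H: "property_H B0 B1" and S: "bounded_in (real_interp A0 A1 \<theta> p) S"
  shows "relatively_compact_in (real_interp B0 B1 \<theta> p) (T ` S)"
proof -
  let ?E = "real_interp B0 B1 \<theta> p"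
  interpret E: Metric_space "carr ?E" "ndist ?E"
    by (rule normed_subspace_Metric_space[OF normed_subspace_real_interp[OF B \<theta> p]])
  note sub = subspace_carr[OF normed_subspace_real_interp[OF B \<theta> p]]
  obtain M where M: "S \<subseteq> carr (real_interp A0 A1 \<theta> p)" "\<And>x. x \<in> S \<Longrightarrow> nrm (real_interp A0 A1 \<theta> p) x \<le> M"
    using S by (auto simp: bounded_in_def)
  define m where "m = max M 0"
  have S': "a \<in> carr A1 \<and> interp_enorm A0 A1 \<theta> p a \<le> ennreal m" if "a \<in> S" for a
  proof
    have a: "a \<in> carr (real_interp A0 A1 \<theta> p)" using that M by blast
    then show "a \<in> carr A1"
      using A01 subspace_add[OF subspace_carr[OF A(2)]] by (auto simp: carr_real_interp couple_sum_def)
    show "interp_enorm A0 A1 \<theta> p a \<le> ennreal m"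
      using M(2)[OF that] by (intro order_trans[OF interp_enorm_le_nrm[OF a] ennreal_leI]) (simp add: m_def)
  qed
  have "E.mtotally_bounded (T ` S)"
  proof (rule E.mtotally_bounded_if_nets)
    fix \<epsilon> :: real assume "0 < \<epsilon>"
    obtain F where F: "finite F" "F \<subseteq> carr ?E"
      "\<And>a. a \<in> carr A1 \<Longrightarrow> interp_enorm A0 A1 \<theta> p a \<le> ennreal m \<Longrightarrow>
      T a \<in> carr ?E \<and> (\<exists>f\<in>F. nrm ?E (T a - f) \<le> \<epsilon> / 2)"
      using image_finite_net[OF H, of m "\<epsilon> / 2"] \<open>0 < \<epsilon>\<close> unfolding m_def
      by (metis half_gt_zero max.cobounded2)
    have "T ` S \<subseteq> (\<Union>f\<in>F. E.mball f \<epsilon>)"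
    proof
      fix y assume "y \<in> T ` S"
      then obtain f where f: "f \<in> F" "y \<in> carr ?E" "nrm ?E (y - f) \<le> \<epsilon> / 2"
        using F(3) S' by blast
      then have "ndist ?E y f < \<epsilon>"
        using \<open>0 < \<epsilon>\<close> F(2) by (auto simp: ndist_def)
      then have "y \<in> E.mball f \<epsilon>"
        using f F(2) E.commute by auto
      then show "y \<in> (\<Union>f\<in>F. E.mball f \<epsilon>)" using f(1) by blast
    qed
    with F(1) show "\<exists>F. finite F \<and> T ` S \<subseteq> (\<Union>f\<in>F. E.mball f \<epsilon>)"
      by (intro exI conjI)
  qed
  then show ?thesis
    by (simp only: relatively_compact_in_def
        E.mtotally_bounded_eq_compact_closure_of[OF mcomplete_real_interp[OF B \<theta> p]])
qed

end

theorem theorem4: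
  fixes A0 A1 :: "('v::hausdorff_tvs) nspace"
    and B0 B1 :: "('w::hausdorff_tvs) nspace"
    and T :: "'v \<Rightarrow> 'w"
    and C0 C1 :: real
    and K :: "'w set"
  assumes "banach_couple A0 A1"
    and "banach_couple B0 B1"
    and "carr A0 \<subseteq> carr A1"
    and "T ` carr A1 \<subseteq> carr B1"
    and "C0 > 0" and "C1 > 0"
    and "T ` carr A0 \<subseteq> carr B0"
    and "\<forall>a\<in>carr A0. nrm B0 (T a) \<le> C0 * nrm A0 a"
    and "\<forall>a\<in>carr A1. \<forall>a'\<in>carr A1. nrm B1 (T a - T a') \<le> C1 * nrm A1 (a - a')"
    and "property_H B0 B1"
    and "compactin (ntopology B0) K"
    and "\<forall>a\<in>carr A0. T a \<in> (\<lambda>k. nrm A0 a *\<^sub>R k) ` K"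
  shows "\<forall>\<theta>::real. \<forall>p::ennreal. 0 < \<theta> \<and> \<theta> < 1 \<and> 1 \<le> p \<longrightarrow>
           (\<forall>S. bounded_in (real_interp A0 A1 \<theta> p) S \<longrightarrow>
                relatively_compact_in (real_interp B0 B1 \<theta> p) (T ` S))"
proof (intro allI impI)
  fix \<theta> :: real and p :: ennreal and S
  assume \<theta>p: "0 < \<theta> \<and> \<theta> < 1 \<and> 1 \<le> p" and S: "bounded_in (real_interp A0 A1 \<theta> p) S"
  have A: "normed_subspace A0" "normed_subspace A1" and B: "embedded_banach B0" "embedded_banach B1"
    using assms(1,2) by (auto simp: banach_couple_def embedded_banach_def)
  show "relatively_compact_in (real_interp B0 B1 \<theta> p) (T ` S)"
    by (rule image_relatively_compact[OF A B assms(3,4,7,6) _ assms(11) _ _ _ _ assms(10) S])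
      (use assms(9,12) \<theta>p in auto)
qed

end
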